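(* Let $Y_1,Y_2,\dots$ be independent, identically distributed, nonnegative random variables with common distribution function $F_Y$ and density $f_Y$. For each $n\ge1$ let $N^{(n)}$ be a nonnegative integer-valued random variable independent of $Y_1,Y_2,\dots$, with generating function $g_{N^{(n)}}(t)=\mathbf{E}[t^{N^{(n)}}]$. Let $S_k=Y_1+\dots+Y_k$, $M_k=\max\{Y_1,\dots,Y_k\}$, let $a_n\ge 0$ be numbers with $a_n\to\infty$, let $p^{(n)}=\mathbf{P}(S_{N^{(n)}}>a_n)$, and assume $\mathbf{P}(M_{N^{(n)}}>a_n)>0$ for every $n$. Suppose that $$\lim_{n\to\infty}\frac{\mathbf{P}(Y_1+\dots+Y_{N^{(n)}}>a_n)}{\mathbf{P}(M_{N^{(n)}}>a_n)}=1 .$$ For each $n$ let $(\overline{\mathbf{Y}}^{(n)}_t)_{t\ge0}$, $\overline{\mathbf{Y}}^{(n)}_t=(N_t,Y_{t,1},\dots,Y_{t,N_t})$, be the Markov chain described in the context, started from its invariant distribution $\pi_n(\cdot)=\mathbf{P}((N^{(n)},Y_1,\dots,Y_{N^{(n)}})\in\cdot\mid S_{N^{(n)}}>a_n)$, and for a fixed integer $T\ge1$ put $$\widehat q^{(n)}_T=\frac{1}{1-g_{N^{(n)}}(F_Y(a_n))}\cdot\frac1T\sum_{t=0}^{T-1}I\Big\{\max_{1\le j\le N_t}Y_{t,j}>a_n\Big\}.$$ Then $\widehat q^{(n)}_T$, as an estimator of $(p^{(n)})^{-1}$, has vanishing normalized variance, that is, $$\lim_{n\to\infty}(p^{(n)})^2\,\mathrm{Var}_{\pi_n}\big(\widehat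 q^{(n)}_T\big)=0 .$$
   Context: Conventions: $S_0=0$ and $\{M_0>a_n\}=\emptyset$. $I\{\cdot\}$ is the indicator function. $\mathrm{Var}_{\pi_n}$ denotes the variance when the Markov chain is stationary, i.e. $\overline{\mathbf{Y}}^{(n)}_0\sim\pi_n$. The Markov chain (for fixed $n$; write $N=N^{(n)}$). Given the state $(k_t,y_{t,1},\dots,y_{t,k_t})$ with $y_{t,1}+\dots+y_{t,k_t}>a_n$, let $k_t^*=\min\{j:y_{t,1}+\dots+y_{t,j}>a_n\}$. The next state is produced as follows. (1) Sample $N_{t+1}$ from $p(k\mid k_t^* )=\mathbf{P}(N=k)I\{k\ge k_t^*\}/\mathbf{P}(N\ge k_t^* )$. If $N_{t+1}>k_t$, sample $N_{t+1}-k_t$ additional values independently from $F_Y$ and append them to $(y_{t,1},\dots,y_{t,k_t})$; if $N_{t+1}\le k_t$, keep only $(y_{t,1},\dots,y_{t,N_{t+1}})$. This gives a vector of length $N_{t+1}$. (2) (a) Draw a uniformly random ordering $j_1,\dots,j_{N_{t+1}}$ of $\{1,\dots,N_{t+1}\}$. (b) For $k=1,\dots,N_{t+1}$ successively: with $j=j_k$, replace the $j$th component of the current vector by a fresh sample from the conditional distribution of $Y\sim F_Y$ given $Y+\sum_{i\neq j}y_i>a_n$, where $y_i$, $i\ne j$, are the current values of the other components (including those already updated). (c) Apply a uniformly random permutation, independent of everything else, to the components of the resulting vector; together with $N_{t+1}$ this is the next state. The distribution $\pi_n$ is invariant for this chain. *)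

theory Defs
  imports "HOL-Probability.Probability" "HOL-Combinatorics.Combinatorics"
begin

text \<open>A state \<open>(k, y)\<close> is a vector of variable length \<open>k\<close>, with components \<open>y 0, \<dots>, y (k - 1)\<close>.
  The components beyond \<open>k\<close> are set to \<open>undefined\<close> by \<^const>\<open>restrict\<close>, which embeds the disjoint
  union of all \<open>\<real>\<^sup>k\<close> measurably into the space below.\<close>

type_synonym state = "nat \<times> (nat \<Rightarrow> real)"

abbreviation seq_space :: "(nat \<Rightarrow> real) measure" where
  "seq_space \<equiv> Pi\<^sub>M UNIV (\<lambda>_. borel)"

abbreviation state_space :: "state measure" where
  "state_space \<equiv> count_space UNIV \<Otimes>\<^sub>M seq_space"

definition sum_exceeds :: "real \<Rightarrow> state \<Rightarrow> bool" where
  "sum_exceeds a s = (case s of (k, y) \<Rightarrow> (\<Sum>i<k. y i) > a)"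

text \<open>The guard \<open>0 < k\<close> encodes the convention that the maximum of an empty vector never exceeds
  the threshold.\<close>

definition max_exceeds :: "real \<Rightarrow> state \<Rightarrow> bool" where
  "max_exceeds a s = (case s of (k, y) \<Rightarrow> 0 < k \<and> Max (y ` {..<k}) > a)"

definition random_vector :: "('w \<Rightarrow> nat) \<Rightarrow> (nat \<Rightarrow> 'w \<Rightarrow> real) \<Rightarrow> 'w \<Rightarrow> state" where
  "random_vector N Y \<omega> = (N \<omega>, \<lambda>i\<in>{..<N \<omega>}. Y i \<omega>)"

definition target_dist :: "'w measure \<Rightarrow> ('w \<Rightarrow> nat) \<Rightarrow> (nat \<Rightarrow> 'w \<Rightarrow> real) \<Rightarrow> real \<Rightarrow> state measure" where
  "target_dist M N Y a =
     distr (uniform_measure M {\<omega> \<in> space M. sum_exceeds a (random_vector N Y \<omega>)})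
       state_space (random_vector N Y)"

definition gen_fun :: "'w measure \<Rightarrow> ('w \<Rightarrow> nat) \<Rightarrow> real \<Rightarrow> real" where
  "gen_fun M N t = prob_space.expectation M (\<lambda>\<omega>. t ^ N \<omega>)"

text \<open>The law \<open>\<mu>\<close> conditioned on \<open>A\<close>. For a null event the conditional law is undefined and \<open>\<mu>\<close> is
  returned instead, so that the transition kernel is a probability kernel on all states; the chain
  started from the target distribution almost surely never meets this case.\<close>

definition cond_law :: "'x measure \<Rightarrow> 'x set \<Rightarrow> 'x measure" where
  "cond_law \<mu> A = (if measure \<mu> A > 0 then uniform_measure \<mu> A else \<mu>)"

definition first_passage :: "real \<Rightarrow> state \<Rightarrow> nat" where
  "first_passage a s = (case s of (k, y) \<Rightarrow> LEAST j. j \<le> k \<and> (\<Sum>i<j. y i) > a)"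

text \<open>The law of the vector of length \<open>m\<close> obtained from the vector \<open>y\<close> of length \<open>k\<close> by appending
  independent samples from \<open>F\<close> if \<open>k < m\<close> and by truncation if \<open>m \<le> k\<close>; in the latter case the
  product below is over the empty set.\<close>

definition resize :: "real measure \<Rightarrow> state \<Rightarrow> nat \<Rightarrow> (nat \<Rightarrow> real) measure" where
  "resize F s m = (case s of (k, y) \<Rightarrow>
     distr (Pi\<^sub>M {k..<m} (\<lambda>_. F)) seq_space (\<lambda>z. \<lambda>i\<in>{..<m}. if i < k then y i else z i))"

text \<open>Successive resampling of the components of \<open>y\<close> (a vector of length \<open>m\<close>) in the order given by
  the list.\<close>

primrec sweep :: "real measure \<Rightarrow> real \<Rightarrow> nat \<Rightarrow> nat list \<Rightarrow> (nat \<Rightarrow> real) \<Rightarrow> (nat \<Rightarrow> real) measure" where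
  "sweep F a m [] y = return seq_space y"
| "sweep F a m (j # js) y = do {
     z \<leftarrow> cond_law F {z. z + (\<Sum>i\<in>{..<m} - {j}. y i) > a};
     sweep F a m js (y(j := z))
   }"

text \<open>The transition kernel, for \<open>F\<close> the law of the summands and \<open>\<nu>\<close> the law of their number.\<close>

definition chain_kernel :: "real measure \<Rightarrow> nat measure \<Rightarrow> real \<Rightarrow> state \<Rightarrow> state measure" where
  "chain_kernel F \<nu> a s = do {
     m \<leftarrow> cond_law \<nu> {first_passage a s..};
     y \<leftarrow> resize F s m;
     js \<leftarrow> measure_pmf (pmf_of_set (permutations_of_set {..<m}));
     y' \<leftarrow> sweep F a m js y;
     \<sigma> \<leftarrow> measure_pmf (pmf_of_set {\<sigma>. \<sigma> permutes {..<m}});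
     return state_space (m, \<lambda>i\<in>{..<m}. y' (\<sigma> i))
   }"

definition markov_chain ::
  "'w measure \<Rightarrow> 's measure \<Rightarrow> ('s \<Rightarrow> 's measure) \<Rightarrow> 's measure \<Rightarrow> (nat \<Rightarrow> 'w \<Rightarrow> 's) \<Rightarrow> bool" where
  "markov_chain M S K \<mu> X \<longleftrightarrow>
     prob_space M \<and> (\<forall>t. X t \<in> M \<rightarrow>\<^sub>M S) \<and> distr M S (X 0) = \<mu> \<and>
     (\<forall>t. \<forall>A \<in> sets (Pi\<^sub>M {..t} (\<lambda>_. S)). \<forall>B \<in> sets S.
        \<P>(\<omega> in M. (\<lambda>i\<in>{..t}. X i \<omega>) \<in> A \<and> X (Suc t) \<omega> \<in> B) =
        (\<integral>\<omega>. indicator A (\<lambda>i\<in>{..t}. X i \<omega>) * measure (K (X t \<omega>)) B \<partial>M))"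

definition q_hat :: "real \<Rightarrow> real \<Rightarrow> nat \<Rightarrow> (nat \<Rightarrow> 'w \<Rightarrow> state) \<Rightarrow> 'w \<Rightarrow> real" where
  "q_hat g a T X \<omega> = 1 / (1 - g) * (1 / real T * (\<Sum>t<T. of_bool (max_exceeds a (X t \<omega>))))"

end

theory Submission
  imports Defs
begin

text \<open>The target law is the law of the infinite i.i.d. sequence together with an independent length \<open>k\<close>,
  conditioned on \<open>y 0 + \<dots> + y (k - 1) > a\<close> and then truncated at \<open>k\<close>. On the untruncated space the first
  step of the chain redraws \<open>k\<close> from its conditional law given the sequence, because appending independent
  samples only reveals further coordinates; the sweep consists of single-site Gibbs updates, and the
  relabelling is a symmetry of the product law. Hence the chain is stationary.

  Consequently the time average of the indicators has mean \<open>r = pmax / p\<close> and values in \<open>[0, 1]\<close>, so its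
  variance is at most \<open>r * (1 - r)\<close>. As the normalising constant \<open>1 - g (F a)\<close> equals \<open>pmax\<close>, the normalised
  variance is at most \<open>p / pmax - 1\<close>, which tends to \<open>0\<close>.\<close>

subsection \<open>Conditional laws and measurability\<close>

lemma measurable_restrict_seq [measurable]: "(\<lambda>y. restrict y A) \<in> seq_space \<rightarrow>\<^sub>M seq_space"
  unfolding restrict_def by (rule measurable_abs_UNIV) measurable

lemma measurable_update_seq [measurable]:
  "(\<lambda>(y, z). y(j := z)) \<in> seq_space \<Otimes>\<^sub>M borel \<rightarrow>\<^sub>M seq_space"
  unfolding fun_upd_def split_beta' by (rule measurable_abs_UNIV) measurable

lemma sets_cond_law [simp, measurable_cong]: "sets (cond_law \<mu> A) = sets \<mu>"
  by (simp add: cond_law_def)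

lemma space_cond_law [simp]: "space (cond_law \<mu> A) = space \<mu>"
  by (simp add: cond_law_def)

lemma prob_space_cond_law:
  assumes "prob_space \<mu>"
  shows "prob_space (cond_law \<mu> A)"
proof -
  interpret prob_space \<mu> by fact
  show ?thesis
    using assms by (auto simp: cond_law_def emeasure_eq_measure intro!: prob_space_uniform_measure)
qed

text \<open>Multiplying by the mass of \<open>A\<close> makes the identity cover null events as
  well: both sides are then 0, whatever fallback law \<open>cond_law\<close> returns.\<close>

lemma nn_integral_cond_law:
  assumes "prob_space \<mu>" and A [measurable]: "A \<in> sets \<mu>" and f [measurable]: "f \<in> borel_measurable \<mu>"
  shows "emeasure \<mu> A * (\<integral>\<^sup>+x. f x \<partial>cond_law \<mu> A) = (\<integral>\<^sup>+x. f x * indicator A x \<partial>\<mu>)"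
proof -
  interpret prob_space \<mu> by fact
  show ?thesis
  proof (cases "measure \<mu> A > 0")
    case True
    then have "emeasure \<mu> A \<noteq> 0" "emeasure \<mu> A \<noteq> \<top>"
      by (auto simp: emeasure_eq_measure)
    with True show ?thesis
      by (simp add: cond_law_def nn_integral_uniform_measure ennreal_times_divide
          mult.commute[of "emeasure \<mu> A"] mult_divide_eq_ennreal)
  next
    case False
    then have "emeasure \<mu> A = 0"
      by (simp add: emeasure_eq_measure zero_less_measure_iff)
    then have "AE x in \<mu>. x \<notin> A"
      by (intro AE_not_in) auto
    then have "(\<integral>\<^sup>+x. f x * indicator A x \<partial>\<mu>) = (\<integral>\<^sup>+x. 0 \<partial>\<mu>)"
      by (intro nn_integral_cong_AE) auto
    with \<open>emeasure \<mu> A = 0\<close> show ?thesis by simp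
  qed
qed

text \<open>The mass that the conditional law gives to \<open>B\<close> is a quotient of measures of
  sections, and these are measurable in \<open>y\<close> because the conditioning events form a
  measurable subset of the product.\<close>

lemma measurable_cond_law:
  assumes "prob_space \<mu>"
    and A: "{x \<in> space (L \<Otimes>\<^sub>M \<mu>). snd x \<in> A (fst x)} \<in> sets (L \<Otimes>\<^sub>M \<mu>)"
    and sub: "\<And>y. A y \<subseteq> space \<mu>"
  shows "(\<lambda>y. cond_law \<mu> (A y)) \<in> L \<rightarrow>\<^sub>M subprob_algebra \<mu>"
proof (rule measurable_subprob_algebra)
  interpret prob_space \<mu> by fact
  show "subprob_space (cond_law \<mu> (A y))" for y
    by (intro prob_space_imp_subprob_space prob_space_cond_law assms)
  fix B assume B [measurable]: "B \<in> sets \<mu>"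
  have Am: "A y \<in> sets \<mu>" if "y \<in> space L" for y
  proof -
    have "A y = Pair y -` {x \<in> space (L \<Otimes>\<^sub>M \<mu>). snd x \<in> A (fst x)}"
      using sub that by (auto simp: space_pair_measure)
    then show ?thesis
      by (metis A sets_Pair1)
  qed
  have [measurable]: "(\<lambda>y. emeasure \<mu> (A y)) \<in> borel_measurable L"
    using sub by (intro measurable_emeasure A) auto
  have "{x \<in> space (L \<Otimes>\<^sub>M \<mu>). snd x \<in> A (fst x) \<inter> B}
      = {x \<in> space (L \<Otimes>\<^sub>M \<mu>). snd x \<in> A (fst x)} \<inter> {x \<in> space (L \<Otimes>\<^sub>M \<mu>). snd x \<in> B}"
    by auto
  also have "\<dots> \<in> sets (L \<Otimes>\<^sub>M \<mu>)"
    by (intro sets.Int A) measurable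
  finally have [measurable]: "(\<lambda>y. emeasure \<mu> (A y \<inter> B)) \<in> borel_measurable L"
    using sub by (intro measurable_emeasure) auto
  have "(\<lambda>y. if emeasure \<mu> (A y) \<noteq> 0 then emeasure \<mu> (A y \<inter> B) / emeasure \<mu> (A y) else emeasure \<mu> B)
      \<in> borel_measurable L"
    by measurable
  also have "?this \<longleftrightarrow> (\<lambda>y. emeasure (cond_law \<mu> (A y)) B) \<in> borel_measurable L"
    by (intro measurable_cong)
      (auto simp: cond_law_def Am measure_eq_0_null_sets emeasure_eq_measure zero_less_measure_iff)
  finally show "(\<lambda>y. emeasure (cond_law \<mu> (A y)) B) \<in> borel_measurable L" .
qed simp

text \<open>Over a finite support the mixture is a finite weighted sum, so measurability in
  \<open>y\<close> for each fixed \<open>x\<close> suffices. This serves the random order and the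
  random relabelling.\<close>

lemma measurable_bind_finite_pmf:
  assumes fin: "finite (set_pmf q)"
    and f: "\<And>x. (\<lambda>y. f x y) \<in> L \<rightarrow>\<^sub>M subprob_algebra R"
  shows "(\<lambda>y. measure_pmf q \<bind> (\<lambda>x. f x y)) \<in> L \<rightarrow>\<^sub>M subprob_algebra R"
proof (rule measurable_subprob_algebra)
  fix y assume y: "y \<in> space L"
  have k: "(\<lambda>x. f x y) \<in> measure_pmf q \<rightarrow>\<^sub>M subprob_algebra R"
    using measurable_space[OF f y] by simp
  show "subprob_space (measure_pmf q \<bind> (\<lambda>x. f x y))"
    by (rule subprob_space_bind[OF _ k]) (rule subprob_space_measure_pmf)
  show "sets (measure_pmf q \<bind> (\<lambda>x. f x y)) = sets R"
    using measurable_space[OF f y] by (intro sets_bind) (auto simp: sets_kernel[OF k])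
next
  fix B assume B [measurable]: "B \<in> sets R"
  note [measurable] = f
  have "(\<lambda>y. \<Sum>x\<in>set_pmf q. emeasure (f x y) B * ennreal (pmf q x)) \<in> borel_measurable L"
    by measurable
  also have "?this \<longleftrightarrow> (\<lambda>y. emeasure (measure_pmf q \<bind> (\<lambda>x. f x y)) B) \<in> borel_measurable L"
  proof (intro measurable_cong)
    fix y assume y: "y \<in> space L"
    have "(\<lambda>x. f x y) \<in> measure_pmf q \<rightarrow>\<^sub>M subprob_algebra R"
      using measurable_space[OF f y] by simp
    then show "(\<Sum>x\<in>set_pmf q. emeasure (f x y) B * ennreal (pmf q x))
        = emeasure (measure_pmf q \<bind> (\<lambda>x. f x y)) B"
      by (simp add: emeasure_bind[OF _ _ B] nn_integral_measure_pmf_finite[OF fin])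
  qed
  finally show "(\<lambda>y. emeasure (measure_pmf q \<bind> (\<lambda>x. f x y)) B) \<in> borel_measurable L" .
qed

lemma measurable_first_passage [measurable]:
  "first_passage a \<in> state_space \<rightarrow>\<^sub>M count_space UNIV"
proof -
  have "(\<lambda>s. LEAST j. j \<le> fst s \<and> (\<Sum>i<j. snd s i) > a) \<in> state_space \<rightarrow>\<^sub>M count_space UNIV"
    by measurable
  then show ?thesis
    by (simp add: first_passage_def[abs_def] split_beta')
qed

text \<open>A series moves the dependence on a varying length law into scalar weights, which can
  then be integrated term by term over the sequences.\<close>

lemma nn_integral_nat_eq_suminf:
  assumes [measurable_cong]: "sets \<mu> = sets (count_space (UNIV :: nat set))"
  shows "(\<integral>\<^sup>+m. f m \<partial>\<mu>) = (\<Sum>m. f m * emeasure \<mu> {m})"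
proof -
  have eq: "f x = (\<Sum>m. f m * indicator {m} x)" for x
    by (subst suminf_finite[of "{x}"]) auto
  have "(\<integral>\<^sup>+m. f m \<partial>\<mu>) = (\<integral>\<^sup>+x. (\<Sum>m. f m * indicator {m} x) \<partial>\<mu>)"
    by (simp only: eq[symmetric])
  also have "\<dots> = (\<Sum>m. \<integral>\<^sup>+x. f m * indicator {m} x \<partial>\<mu>)"
    by (rule nn_integral_suminf) measurable
  also have "\<dots> = (\<Sum>m. f m * emeasure \<mu> {m})"
    by (simp add: nn_integral_cmult_indicator assms)
  finally show ?thesis .
qed

lemma sum_const_divide_card:
  fixes c :: ennreal
  assumes "finite A" "A \<noteq> {}"
  shows "(\<Sum>x\<in>A. c) / of_nat (card A) = c"
proof -
  have "(\<Sum>x\<in>A. c) / of_nat (card A) = c * of_nat (card A) / of_nat (card A)"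
    by (simp add: mult.commute)
  also have "\<dots> = c"
    using assms by (intro mult_divide_eq_ennreal) auto
  finally show ?thesis .
qed

lemma ennreal_sum_divide_times:
  fixes c d :: ennreal
  shows "(\<Sum>x\<in>A. f x) / c * d = (\<Sum>x\<in>A. f x * d) / c"
  unfolding divide_ennreal_def sum_distrib_right[symmetric] by (simp only: ac_simps)

subsection \<open>The transition kernel\<close>

text \<open>Stationarity is a statement about \<open>F\<close> and \<open>\<nu>\<close> alone, so it
  is proved on product measures, detached from any random variables with these laws.\<close>

locale sampler =
  fixes F :: "real measure" and \<nu> :: "nat measure"
  assumes prob_F: "prob_space F" and sets_F [measurable_cong]: "sets F = sets borel"
    and prob_\<nu>: "prob_space \<nu>" and sets_\<nu> [measurable_cong]: "sets \<nu> = sets (count_space UNIV)"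
    and nonneg: "AE z in F. 0 \<le> z"
begin

abbreviation P :: "(nat \<Rightarrow> real) measure" where
  "P \<equiv> Pi\<^sub>M UNIV (\<lambda>_. F)"

sublocale F: prob_space F by (rule prob_F)
sublocale \<nu>: prob_space \<nu> by (rule prob_\<nu>)
sublocale P: product_prob_space "\<lambda>_::nat. F" UNIV ..

lemma sets_P [measurable_cong]: "sets P = sets seq_space"
  by (intro sets_PiM_cong) (simp_all add: sets_F)

lemma space_F [simp]: "space F = UNIV"
  using sets_eq_imp_space_eq[OF sets_F] by simp

lemma space_\<nu> [simp]: "space \<nu> = UNIV"
  using sets_eq_imp_space_eq[OF sets_\<nu>] by simp

lemma space_P [simp]: "space P = UNIV"
  by (simp add: space_PiM)

lemma subprob_algebra_F: "subprob_algebra F = subprob_algebra borel"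
  by (rule subprob_algebra_cong) (rule sets_F)

lemma measurable_cond_site:
  "(\<lambda>y. cond_law F {z. z + (\<Sum>i\<in>J. y i) > a}) \<in> seq_space \<rightarrow>\<^sub>M subprob_algebra borel"
proof -
  have "(\<lambda>y. cond_law F {z. z + (\<Sum>i\<in>J. y i) > a}) \<in> seq_space \<rightarrow>\<^sub>M subprob_algebra F"
  proof (rule measurable_cond_law[OF prob_F])
    show "{x \<in> space (seq_space \<Otimes>\<^sub>M F). snd x \<in> {z. z + (\<Sum>i\<in>J. fst x i) > a}}
       \<in> sets (seq_space \<Otimes>\<^sub>M F)" by simp
  qed simp
  then show ?thesis by (simp add: subprob_algebra_F)
qed

lemma measurable_sweep: "sweep F a m js \<in> seq_space \<rightarrow>\<^sub>M subprob_algebra seq_space"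
proof (induction js)
  case Nil
  show ?case unfolding sweep.simps(1)[abs_def] by measurable
next
  case (Cons j js)
  show ?case
    unfolding sweep.simps(2)[abs_def]
  proof (rule measurable_bind'[OF measurable_cond_site])
    show "(\<lambda>(y, z). sweep F a m js (y(j := z))) \<in> seq_space \<Otimes>\<^sub>M borel \<rightarrow>\<^sub>M subprob_algebra seq_space"
      using measurable_compose[OF measurable_update_seq[of j] Cons] by (simp only: split_beta')
  qed
qed

text \<open>The part of a transition that follows the choice of the length and the resizing. It is
  split off because it preserves the conditioned product law for each fixed \<open>m\<close>
  separately.\<close>

definition refresh :: "real \<Rightarrow> nat \<Rightarrow> (nat \<Rightarrow> real) \<Rightarrow> state measure" where
  "refresh a m y = do {
     js \<leftarrow> measure_pmf (pmf_of_set (permutations_of_set {..<m}));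
     y' \<leftarrow> sweep F a m js y;
     \<sigma> \<leftarrow> measure_pmf (pmf_of_set {\<sigma>. \<sigma> permutes {..<m}});
     return state_space (m, \<lambda>i\<in>{..<m}. y' (\<sigma> i))
   }"

lemma permutes_nonempty: "{\<sigma>. \<sigma> permutes A} \<noteq> {}"
  using permutes_id by blast

lemma measurable_permuted [measurable]:
  "(\<lambda>y. (m, \<lambda>i\<in>{..<m}. y (\<sigma> i))) \<in> seq_space \<rightarrow>\<^sub>M state_space"
proof -
  have "(\<lambda>y. \<lambda>i\<in>{..<m}. y (\<sigma> i)) \<in> seq_space \<rightarrow>\<^sub>M seq_space"
    unfolding restrict_def by (rule measurable_abs_UNIV) measurable
  then show ?thesis by measurable
qed

lemma measurable_relabel:
  "(\<lambda>y. measure_pmf (pmf_of_set {\<sigma>. \<sigma> permutes {..<m}}) \<bind>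
     (\<lambda>\<sigma>. return state_space (m, \<lambda>i\<in>{..<m}. y (\<sigma> i)))) \<in> seq_space \<rightarrow>\<^sub>M subprob_algebra state_space"
proof (rule measurable_bind_finite_pmf)
  show "finite (set_pmf (pmf_of_set {\<sigma>. \<sigma> permutes {..<m}}))"
    by (subst set_pmf_of_set) (rule permutes_nonempty finite_permutations finite_lessThan)+
qed simp

lemma measurable_refresh [measurable]: "refresh a m \<in> seq_space \<rightarrow>\<^sub>M subprob_algebra state_space"
  unfolding refresh_def[abs_def]
  by (rule measurable_bind_finite_pmf)
    (auto simp: permutations_of_set_nonempty intro!: measurable_bind2[OF measurable_sweep measurable_relabel])

lemma measurable_resize: "(\<lambda>s. resize F s m) \<in> state_space \<rightarrow>\<^sub>M subprob_algebra seq_space"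
proof (rule measurable_pair_measure_countable1)
  fix k
  interpret Q: prob_space "Pi\<^sub>M {k..<m} (\<lambda>_. F)"
    by (intro prob_space_PiM prob_F)
  have "(\<lambda>y. distr (Pi\<^sub>M {k..<m} (\<lambda>_. F)) seq_space (\<lambda>z. \<lambda>i\<in>{..<m}. if i < k then y i else z i))
      \<in> seq_space \<rightarrow>\<^sub>M subprob_algebra seq_space"
  proof (rule measurable_distr2)
    show "(\<lambda>(y, z). \<lambda>i\<in>{..<m}. if i < k then y i else z i)
        \<in> seq_space \<Otimes>\<^sub>M Pi\<^sub>M {k..<m} (\<lambda>_. F) \<rightarrow>\<^sub>M seq_space"
      unfolding restrict_def split_beta'
    proof (rule measurable_abs_UNIV)
      fix i
      show "(\<lambda>x. if i \<in> {..<m} then if i < k then fst x i else snd x i else undefined)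
           \<in> borel_measurable (seq_space \<Otimes>\<^sub>M Pi\<^sub>M {k..<m} (\<lambda>_. F))"
        \<comment> \<open>Coordinate \<open>i\<close> of the product over \<open>{k..<m}\<close> is
          read only when \<open>k \<le> i\<close> and \<open>i < m\<close>, where the projection is
          measurable.\<close>
        by (cases "i < m"; cases "i < k") auto
    qed
    show "(\<lambda>_. Pi\<^sub>M {k..<m} (\<lambda>_. F)) \<in> seq_space \<rightarrow>\<^sub>M subprob_algebra (Pi\<^sub>M {k..<m} (\<lambda>_. F))"
      by (intro measurable_const) (simp add: space_subprob_algebra Q.subprob_space_axioms)
  qed
  then show "(\<lambda>y. resize F (k, y) m) \<in> seq_space \<rightarrow>\<^sub>M subprob_algebra seq_space"
    by (simp add: resize_def)
qed simp

lemma measurable_resize_refresh: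
  "(\<lambda>s. resize F s m \<bind> refresh a m) \<in> state_space \<rightarrow>\<^sub>M subprob_algebra state_space"
  by (rule measurable_bind2[OF measurable_resize measurable_refresh])

lemma chain_kernel_eq:
  "chain_kernel F \<nu> a s = cond_law \<nu> {first_passage a s..} \<bind> (\<lambda>m. resize F s m \<bind> refresh a m)"
  by (simp add: chain_kernel_def refresh_def[abs_def])

lemma measurable_cond_passage:
  "(\<lambda>s. cond_law \<nu> {first_passage a s..}) \<in> state_space \<rightarrow>\<^sub>M subprob_algebra (count_space UNIV)"
proof -
  have "(\<lambda>j. cond_law \<nu> {j..}) \<in> count_space UNIV \<rightarrow>\<^sub>M subprob_algebra (count_space UNIV)"
    by (auto simp: space_subprob_algebra sets_\<nu> intro!: prob_space_imp_subprob_space prob_space_cond_law prob_\<nu>)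
  from measurable_compose[OF measurable_first_passage this] show ?thesis .
qed

lemma measurable_chain_kernel: "chain_kernel F \<nu> a \<in> state_space \<rightarrow>\<^sub>M subprob_algebra state_space"
  unfolding chain_kernel_eq[abs_def]
proof (rule measurable_bind'[OF measurable_cond_passage])
  have "(\<lambda>x. resize F (fst x) (snd x) \<bind> refresh a (snd x))
      \<in> state_space \<Otimes>\<^sub>M count_space UNIV \<rightarrow>\<^sub>M subprob_algebra state_space"
    by (rule measurable_compose_countable[where f="\<lambda>m x. resize F (fst x) m \<bind> refresh a m"])
      (auto intro: measurable_compose[OF _ measurable_resize_refresh])
  then show "(\<lambda>(s, m). resize F s m \<bind> refresh a m)
      \<in> state_space \<Otimes>\<^sub>M count_space UNIV \<rightarrow>\<^sub>M subprob_algebra state_space"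
    by (simp add: split_beta')
qed

lemma emeasure_chain_kernel:
  assumes B: "B \<in> sets state_space"
  shows "emeasure (chain_kernel F \<nu> a s) B =
    (\<integral>\<^sup>+m. \<integral>\<^sup>+y. emeasure (refresh a m y) B \<partial>resize F s m \<partial>cond_law \<nu> {first_passage a s..})"
proof -
  have s: "s \<in> space state_space" by (simp add: space_pair_measure space_PiM)
  have inner: "emeasure (resize F s m \<bind> refresh a m) B = (\<integral>\<^sup>+y. emeasure (refresh a m y) B \<partial>resize F s m)" for m
  proof -
    note r = subprob_measurableD[OF measurable_resize[of m] s]
    show ?thesis
      by (rule emeasure_bind[OF _ _ B]) (auto simp: r space_PiM)
  qed
  have "emeasure (chain_kernel F \<nu> a s) B
      = (\<integral>\<^sup>+m. emeasure (resize F s m \<bind> refresh a m) B \<partial>cond_law \<nu> {first_passage a s..})"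
    unfolding chain_kernel_eq
  proof (rule emeasure_bind[OF _ _ B])
    show "(\<lambda>m. resize F s m \<bind> refresh a m) \<in> cond_law \<nu> {first_passage a s..} \<rightarrow>\<^sub>M subprob_algebra state_space"
      using measurable_space[OF measurable_resize_refresh s]
      by (simp add: measurable_cong_sets[of "cond_law \<nu> A" "count_space UNIV" for A, OF _ refl] sets_\<nu>)
  qed simp
  then show ?thesis
    by (simp add: inner)
qed

subsection \<open>Invariance under the Gibbs sweep and the relabelling\<close>

lemma pair_sigma_finite_PP: "pair_sigma_finite P P"
  by (simp add: pair_sigma_finite_def P.sigma_finite_measure_axioms)

lemma measurable_nn_integral_sweep [measurable]:
  assumes [measurable]: "f \<in> borel_measurable seq_space"
  shows "(\<lambda>y. \<integral>\<^sup>+y'. f y' \<partial>sweep F a m js y) \<in> borel_measurable seq_space"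
  by (rule nn_integral_measurable_subprob_algebra2[OF _ measurable_sweep]) measurable

text \<open>Overwriting one coordinate of an i.i.d. sequence by an independent sample from
  \<open>F\<close> gives an i.i.d. sequence again. Both the Gibbs updates and the splicing of
  sequences are reduced to this fact.\<close>

lemma nn_integral_P_update:
  assumes f [measurable]: "f \<in> borel_measurable seq_space"
  shows "(\<integral>\<^sup>+y. f y \<partial>P) = (\<integral>\<^sup>+y. \<integral>\<^sup>+z. f (y(j := z)) \<partial>F \<partial>P)"
proof -
  interpret FP: pair_sigma_finite F P ..
  have [measurable]: "(\<lambda>(z, y). y(j := z)) \<in> F \<Otimes>\<^sub>M P \<rightarrow>\<^sub>M seq_space"
    using measurable_compose[OF measurable_pair_swap' measurable_update_seq[of j]]
    by (simp add: split_beta' measurable_cong_sets[OF sets_pair_measure_cong[OF sets_F sets_P] refl])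
  have "(\<integral>\<^sup>+y. f y \<partial>P) = (\<integral>\<^sup>+y. f y \<partial>distr (F \<Otimes>\<^sub>M P) P (\<lambda>(z, y). y(j := z)))"
    using distr_pair_PiM_eq_PiM[of UNIV "\<lambda>_. F" j] by (simp add: prob_F)
  also have "\<dots> = (\<integral>\<^sup>+(z, y). f (y(j := z)) \<partial>(F \<Otimes>\<^sub>M P))"
    by (subst nn_integral_distr) (simp_all add: split_beta')
  also have "\<dots> = (\<integral>\<^sup>+y. \<integral>\<^sup>+z. f (y(j := z)) \<partial>F \<partial>P)"
    by (subst FP.nn_integral_snd[symmetric]) (simp_all add: split_beta')
  finally show ?thesis .
qed

lemma sum_update_eq:
  fixes y :: "nat \<Rightarrow> real"
  assumes "j < m"
  shows "(\<Sum>i<m. (y(j := z)) i) = z + (\<Sum>i\<in>{..<m} - {j}. y i)"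
proof -
  have "(\<Sum>i<m. (y(j := z)) i) = (y(j := z)) j + (\<Sum>i\<in>{..<m} - {j}. (y(j := z)) i)"
    using assms by (intro sum.remove) auto
  also have "\<dots> = z + (\<Sum>i\<in>{..<m} - {j}. y i)"
    by (intro arg_cong2[where f="(+)"] sum.cong) auto
  finally show ?thesis .
qed

text \<open>Given the other coordinates, the old value \<open>y j\<close> and the new value \<open>z\<close> have the same law, namely
  \<open>F\<close> conditioned on \<open>z + (\<Sum>i\<in>{..<m} - {j}. y i) > a\<close>.\<close>

lemma nn_integral_gibbs_update:
  assumes j: "j < m" and f [measurable]: "f \<in> borel_measurable seq_space"
  shows "(\<integral>\<^sup>+y. (\<integral>\<^sup>+z. f (y(j := z)) \<partial>cond_law F {z. z + (\<Sum>i\<in>{..<m} - {j}. y i) > a})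
            * indicator {y. (\<Sum>i<m. y i) > a} y \<partial>P)
    = (\<integral>\<^sup>+y. f y * indicator {y. (\<Sum>i<m. y i) > a} y \<partial>P)"
proof -
  let ?A = "\<lambda>y. {z. z + (\<Sum>i\<in>{..<m} - {j}. y i) > a}"
  let ?C = "\<lambda>y. \<integral>\<^sup>+z. f (y(j := z)) \<partial>cond_law F (?A y)"
  have fu [measurable]: "(\<lambda>(y, z). f (y(j := z))) \<in> borel_measurable (seq_space \<Otimes>\<^sub>M borel)"
    using measurable_compose[OF measurable_update_seq f] by (simp only: split_beta')
  have fz [measurable]: "(\<lambda>z. f (y(j := z))) \<in> borel_measurable F" for y
    using measurable_compose[OF measurable_Pair1' fu, of y]
    by (simp add: space_PiM measurable_cong_sets[OF sets_F refl])
  have [measurable]: "?C \<in> borel_measurable seq_space"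
    by (rule nn_integral_measurable_subprob_algebra2[OF fu measurable_cond_site])
  have A [measurable]: "?A y \<in> sets F" for y
    unfolding sets_F by measurable
  have upd: "(\<Sum>i\<in>{..<m} - {j}. (y(j := z)) i) = (\<Sum>i\<in>{..<m} - {j}. y i)" for y :: "nat \<Rightarrow> real" and z
    by (intro sum.cong) auto
  have ind: "indicator {y. (\<Sum>i<m. y i) > a} (y(j := z)) = (indicator (?A y) z :: ennreal)" for y z
    by (simp only: indicator_def mem_Collect_eq sum_update_eq[OF j])
  have "(\<integral>\<^sup>+y. ?C y * indicator {y. (\<Sum>i<m. y i) > a} y \<partial>P)
      = (\<integral>\<^sup>+y. \<integral>\<^sup>+z. ?C (y(j := z)) * indicator {y. (\<Sum>i<m. y i) > a} (y(j := z)) \<partial>F \<partial>P)"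
    by (rule nn_integral_P_update) measurable
  \<comment> \<open>The law of the fresh value depends on the other coordinates only. Hence
    overwriting coordinate \<open>j\<close> leaves \<open>?C\<close> unchanged and turns the event
    for the sum into the event \<open>?A y\<close> for \<open>z\<close>.\<close>
  also have "\<dots> = (\<integral>\<^sup>+y. \<integral>\<^sup>+z. ?C y * indicator (?A y) z \<partial>F \<partial>P)"
    by (simp only: ind upd fun_upd_upd)
  also have "\<dots> = (\<integral>\<^sup>+y. emeasure F (?A y) * ?C y \<partial>P)"
    by (simp only: nn_integral_cmult_indicator[OF A]) (simp only: mult.commute)
  also have "\<dots> = (\<integral>\<^sup>+y. \<integral>\<^sup>+z. f (y(j := z)) * indicator (?A y) z \<partial>F \<partial>P)"
    by (simp only: nn_integral_cond_law[OF prob_F A fz])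
  also have "\<dots> = (\<integral>\<^sup>+y. \<integral>\<^sup>+z. f (y(j := z)) * indicator {y. (\<Sum>i<m. y i) > a} (y(j := z)) \<partial>F \<partial>P)"
    by (simp only: ind)
  also have "\<dots> = (\<integral>\<^sup>+y. f y * indicator {y. (\<Sum>i<m. y i) > a} y \<partial>P)"
    by (rule nn_integral_P_update[symmetric]) measurable
  finally show ?thesis .
qed

lemma nn_integral_sweep_Cons:
  assumes f: "f \<in> borel_measurable seq_space"
  shows "(\<integral>\<^sup>+y'. f y' \<partial>sweep F a m (j # js) y)
    = (\<integral>\<^sup>+z. \<integral>\<^sup>+y'. f y' \<partial>sweep F a m js (y(j := z)) \<partial>cond_law F {z. z + (\<Sum>i\<in>{..<m} - {j}. y i) > a})"
proof -
  have "(\<lambda>z. y(j := z)) \<in> borel \<rightarrow>\<^sub>M seq_space"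
    using measurable_compose[OF measurable_Pair1' measurable_update_seq, of y j] by (simp add: space_PiM)
  from measurable_compose[OF this measurable_sweep]
  have "(\<lambda>z. sweep F a m js (y(j := z))) \<in> cond_law F A \<rightarrow>\<^sub>M subprob_algebra seq_space" for A
    by (simp add: measurable_cong_sets[of "cond_law F A" borel, OF _ refl] sets_F)
  then show ?thesis
    by (simp add: nn_integral_bind[OF f])
qed

text \<open>Induction over the order of updates: with the integral over the remaining sweep as test
  function, the first update is a single Gibbs step.\<close>

lemma nn_integral_sweep_invariant:
  assumes "set js \<subseteq> {..<m}" and f [measurable]: "f \<in> borel_measurable seq_space"
  shows "(\<integral>\<^sup>+y. (\<integral>\<^sup>+y'. f y' \<partial>sweep F a m js y) * indicator {y. (\<Sum>i<m. y i) > a} y \<partial>P)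
    = (\<integral>\<^sup>+y. f y * indicator {y. (\<Sum>i<m. y i) > a} y \<partial>P)"
  using assms(1)
proof (induction js)
  case Nil
  show ?case
    by (simp add: nn_integral_return space_PiM)
next
  case (Cons j js)
  then have j: "j < m" by simp
  show ?case
    using Cons nn_integral_gibbs_update[OF j, of "\<lambda>y. \<integral>\<^sup>+y'. f y' \<partial>sweep F a m js y" a]
    by (simp add: nn_integral_sweep_Cons[OF f] del: sweep.simps)
qed

text \<open>The updates read and write only coordinates below \<open>m\<close>. The chain sees a
  truncated vector while \<open>P\<close> lives on infinite sequences; this is what allows the
  truncation to be dropped before sweeping.\<close>

lemma nn_integral_sweep_local:
  assumes "set js \<subseteq> {..<m}" "\<And>i. i < m \<Longrightarrow> y i = y' i"
    and f [measurable]: "f \<in> borel_measurable seq_space"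
    and local: "\<And>x x'. (\<And>i. i < m \<Longrightarrow> x i = x' i) \<Longrightarrow> f x = f x'"
  shows "(\<integral>\<^sup>+x. f x \<partial>sweep F a m js y) = (\<integral>\<^sup>+x. f x \<partial>sweep F a m js y')"
  using assms(1,2)
proof (induction js arbitrary: y y')
  case Nil
  then show ?case
    using local[of y y'] by (simp add: nn_integral_return space_PiM)
next
  case (Cons j js)
  have "(\<Sum>i\<in>{..<m} - {j}. y i) = (\<Sum>i\<in>{..<m} - {j}. y' i)"
    by (intro sum.cong) (auto simp: Cons.prems)
  moreover have "(\<integral>\<^sup>+x. f x \<partial>sweep F a m js (y(j := z))) = (\<integral>\<^sup>+x. f x \<partial>sweep F a m js (y'(j := z)))" for z
    using Cons.prems by (intro Cons.IH) auto
  ultimately show ?case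
    by (simp add: nn_integral_sweep_Cons[OF f] del: sweep.simps)
qed

text \<open>Exchangeability: an injective reindexing preserves a product of identical
  factors.\<close>

lemma nn_integral_P_permute:
  assumes \<sigma>: "\<sigma> permutes A" and f [measurable]: "f \<in> borel_measurable seq_space"
  shows "(\<integral>\<^sup>+y. f (\<lambda>i. y (\<sigma> i)) \<partial>P) = (\<integral>\<^sup>+y. f y \<partial>P)"
proof -
  have [measurable]: "(\<lambda>y i. y (\<sigma> i)) \<in> P \<rightarrow>\<^sub>M seq_space"
    by (rule measurable_abs_UNIV) measurable
  have "(\<integral>\<^sup>+y. f y \<partial>P) = (\<integral>\<^sup>+y. f y \<partial>distr P P (\<lambda>y i. y (\<sigma> i)))"
    using distr_PiM_reindex[of UNIV "\<lambda>_. F" \<sigma> UNIV] permutes_inj[OF \<sigma>] by (simp add: prob_F restrict_UNIV)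
  also have "\<dots> = (\<integral>\<^sup>+y. f (\<lambda>i. y (\<sigma> i)) \<partial>P)"
    by (rule nn_integral_distr) measurable
  finally show ?thesis ..
qed

text \<open>For fixed \<open>m\<close> both random choices are finite averages. Every order of
  updates preserves the product law restricted to the event for the sum, and so does every
  relabelling, because the sum is symmetric; averaging equal values changes nothing.\<close>

lemma nn_integral_refresh_invariant:
  assumes B [measurable]: "B \<in> sets state_space"
  shows "(\<integral>\<^sup>+y. emeasure (refresh a m (restrict y {..<m})) B * indicator {y. (\<Sum>i<m. y i) > a} y \<partial>P)
    = (\<integral>\<^sup>+y. indicator B (m, restrict y {..<m}) * indicator {y. (\<Sum>i<m. y i) > a} y \<partial>P)"
proof -
  let ?S = "{y :: nat \<Rightarrow> real. (\<Sum>i<m. y i) > a}"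
  let ?J = "permutations_of_set {..<m}" and ?\<Pi> = "{\<sigma>. \<sigma> permutes {..<m}}"
  let ?b = "\<lambda>y. indicator B (m, restrict y {..<m}) :: ennreal"
  have J: "finite ?J" "?J \<noteq> {}" by (simp_all add: permutations_of_set_nonempty)
  have \<Pi>: "finite ?\<Pi>" "?\<Pi> \<noteq> {}"
    by (rule permutes_nonempty finite_permutations finite_lessThan)+
  \<comment> \<open>\<open>g y\<close> is the probability that a uniform relabelling of the first
    \<open>m\<close> components of \<open>y\<close> lands in \<open>B\<close>. It is the test
    function for the sweep.\<close>
  define g where "g y = (\<Sum>\<sigma>\<in>?\<Pi>. indicator B (m, \<lambda>i\<in>{..<m}. y (\<sigma> i))) / (of_nat (card ?\<Pi>) :: ennreal)" for y
  have g [measurable]: "g \<in> borel_measurable seq_space"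
    unfolding g_def by measurable
  have g_eq: "emeasure (measure_pmf (pmf_of_set ?\<Pi>) \<bind> (\<lambda>\<sigma>. return state_space (m, \<lambda>i\<in>{..<m}. y (\<sigma> i)))) B = g y" for y
  proof -
    have "emeasure (measure_pmf (pmf_of_set ?\<Pi>) \<bind> (\<lambda>\<sigma>. return state_space (m, \<lambda>i\<in>{..<m}. y (\<sigma> i)))) B
       = (\<integral>\<^sup>+\<sigma>. emeasure (return state_space (m, \<lambda>i\<in>{..<m}. y (\<sigma> i))) B \<partial>measure_pmf (pmf_of_set ?\<Pi>))"
      by (rule emeasure_bind[OF _ _ B])
        (auto simp: space_subprob_algebra space_pair_measure space_PiM intro!: prob_space_imp_subprob_space prob_space_return)
    also have "\<dots> = g y"
      by (subst nn_integral_pmf_of_set[OF \<Pi>(2,1)]) (simp add: g_def)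
    finally show ?thesis .
  qed
  have refresh_eq: "emeasure (refresh a m y) B = (\<Sum>js\<in>?J. \<integral>\<^sup>+y'. g y' \<partial>sweep F a m js y) / of_nat (card ?J)" for y
  proof -
    have y: "y \<in> space seq_space" by (simp add: space_PiM)
    let ?R = "\<lambda>y'. measure_pmf (pmf_of_set ?\<Pi>) \<bind> (\<lambda>\<sigma>. return state_space (m, \<lambda>i\<in>{..<m}. y' (\<sigma> i)))"
    have "?R \<in> sweep F a m js y \<rightarrow>\<^sub>M subprob_algebra state_space" for js
      unfolding subprob_measurableD(3)[OF measurable_sweep y] by (rule measurable_relabel)
    moreover have "space (sweep F a m js y) \<noteq> {}" for js
      unfolding subprob_measurableD(1)[OF measurable_sweep y] using y by blast
    ultimately have inner: "emeasure (sweep F a m js y \<bind> ?R) B = (\<integral>\<^sup>+y'. g y' \<partial>sweep F a m js y)" for js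
      by (subst emeasure_bind[OF _ _ B]) (simp_all only: g_eq not_False_eq_True)
    have "emeasure (refresh a m y) B = (\<integral>\<^sup>+js. emeasure (sweep F a m js y \<bind> ?R) B \<partial>measure_pmf (pmf_of_set ?J))"
      unfolding refresh_def
      using measurable_space[OF measurable_bind2[OF measurable_sweep measurable_relabel] y]
      by (intro emeasure_bind[OF _ _ B]) auto
    then show ?thesis
      by (simp only: inner nn_integral_pmf_of_set[OF J(2,1)])
  qed
  \<comment> \<open>A permutation of \<open>{..<m}\<close> maps this set into itself, so
    \<open>g\<close> reads only the first \<open>m\<close> coordinates.\<close>
  have local: "g x = g x'" if "\<And>i. i < m \<Longrightarrow> x i = x' i" for x x'
  proof -
    have "(\<lambda>i\<in>{..<m}. x (\<sigma> i)) = (\<lambda>i\<in>{..<m}. x' (\<sigma> i))" if "\<sigma> permutes {..<m}" for \<sigma>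
      using \<open>\<And>i. i < m \<Longrightarrow> x i = x' i\<close> permutes_in_image[OF that]
      by (intro ext) (auto simp: restrict_def)
    then show ?thesis
      unfolding g_def by (intro arg_cong2[where f="(/)"] sum.cong) auto
  qed
  have "(\<integral>\<^sup>+y. emeasure (refresh a m (restrict y {..<m})) B * indicator ?S y \<partial>P)
     = (\<integral>\<^sup>+y. (\<Sum>js\<in>?J. (\<integral>\<^sup>+y'. g y' \<partial>sweep F a m js y) * indicator ?S y) / of_nat (card ?J) \<partial>P)"
  proof (rule nn_integral_cong)
    fix y
    have "(\<integral>\<^sup>+y'. g y' \<partial>sweep F a m js (restrict y {..<m})) = (\<integral>\<^sup>+y'. g y' \<partial>sweep F a m js y)"
      if "js \<in> ?J" for js
      using that by (intro nn_integral_sweep_local[OF _ _ g local]) (auto simp: permutations_of_set_def)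
    then show "emeasure (refresh a m (restrict y {..<m})) B * indicator ?S y
      = (\<Sum>js\<in>?J. (\<integral>\<^sup>+y'. g y' \<partial>sweep F a m js y) * indicator ?S y) / of_nat (card ?J)"
      by (simp add: refresh_eq ennreal_sum_divide_times)
  qed
  also have "\<dots> = (\<Sum>js\<in>?J. \<integral>\<^sup>+y. (\<integral>\<^sup>+y'. g y' \<partial>sweep F a m js y) * indicator ?S y \<partial>P) / of_nat (card ?J)"
    by (subst nn_integral_divide, measurable, subst nn_integral_sum) auto
  also have "\<dots> = (\<Sum>js\<in>?J. \<integral>\<^sup>+y. g y * indicator ?S y \<partial>P) / of_nat (card ?J)"
    by (intro arg_cong2[where f="(/)"] sum.cong refl nn_integral_sweep_invariant g)
      (auto simp: permutations_of_set_def)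
  also have "\<dots> = (\<integral>\<^sup>+y. g y * indicator ?S y \<partial>P)"
    by (rule sum_const_divide_card[OF J])
  also have "\<dots> = (\<integral>\<^sup>+y. (\<Sum>\<sigma>\<in>?\<Pi>. ?b (\<lambda>i. y (\<sigma> i)) * indicator ?S y) / of_nat (card ?\<Pi>) \<partial>P)"
    by (simp add: g_def ennreal_sum_divide_times restrict_def)
  also have "\<dots> = (\<Sum>\<sigma>\<in>?\<Pi>. \<integral>\<^sup>+y. ?b (\<lambda>i. y (\<sigma> i)) * indicator ?S y \<partial>P) / of_nat (card ?\<Pi>)"
    by (subst nn_integral_divide, measurable, subst nn_integral_sum) auto
  also have "\<dots> = (\<Sum>\<sigma>\<in>?\<Pi>. \<integral>\<^sup>+y. ?b y * indicator ?S y \<partial>P) / of_nat (card ?\<Pi>)"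
  proof (intro arg_cong2[where f="(/)"] sum.cong refl)
    fix \<sigma> assume "\<sigma> \<in> ?\<Pi>"
    then have \<sigma>: "\<sigma> permutes {..<m}" by simp
    have "(\<Sum>i<m. y (\<sigma> i)) = (\<Sum>i<m. y i)" for y :: "nat \<Rightarrow> real"
      using sum.permute[OF \<sigma>, of y] by (simp add: o_def)
    then have "(\<integral>\<^sup>+y. ?b (\<lambda>i. y (\<sigma> i)) * indicator ?S y \<partial>P)
        = (\<integral>\<^sup>+y. ?b (\<lambda>i. y (\<sigma> i)) * indicator ?S (\<lambda>i. y (\<sigma> i)) \<partial>P)"
      by (simp add: indicator_def)
    also have "\<dots> = (\<integral>\<^sup>+y. ?b y * indicator ?S y \<partial>P)"
      by (rule nn_integral_P_permute[OF \<sigma>]) measurable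
    finally show "(\<integral>\<^sup>+y. ?b (\<lambda>i. y (\<sigma> i)) * indicator ?S y \<partial>P) = (\<integral>\<^sup>+y. ?b y * indicator ?S y \<partial>P)" .
  qed
  also have "\<dots> = (\<integral>\<^sup>+y. ?b y * indicator ?S y \<partial>P)"
    by (rule sum_const_divide_card[OF \<Pi>])
  finally show ?thesis .
qed

subsection \<open>Invariance under redrawing the length\<close>

lemma measurable_splice:
  "(\<lambda>(y, z) i. if i < k then y i else z i) \<in> seq_space \<Otimes>\<^sub>M seq_space \<rightarrow>\<^sub>M seq_space"
  unfolding split_beta' by (rule measurable_abs_UNIV) measurable

lemma measurable_splice1: "(\<lambda>y i. if i < k then y i else z i) \<in> seq_space \<rightarrow>\<^sub>M seq_space"
  by (rule measurable_abs_UNIV) measurable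

lemma measurable_splice2: "(\<lambda>z i. if i < k then y i else z i) \<in> seq_space \<rightarrow>\<^sub>M seq_space"
  by (rule measurable_abs_UNIV) measurable

text \<open>Two independent i.i.d. sequences glued together at \<open>k\<close> form an i.i.d.
  sequence. The induction moves the gluing point by one coordinate at a time.\<close>

lemma nn_integral_P_splice:
  assumes "f \<in> borel_measurable seq_space"
  shows "(\<integral>\<^sup>+z. \<integral>\<^sup>+y. f (\<lambda>i. if i < k then y i else z i) \<partial>P \<partial>P) = (\<integral>\<^sup>+y. f y \<partial>P)"
  using assms
proof (induction k arbitrary: f)
  case 0
  then show ?case
    using P.emeasure_space_1 by simp
next
  case (Suc k)
  note [measurable] = Suc.prems
  \<comment> \<open>\<open>f'\<close> averages over coordinate \<open>k\<close>, the one that passes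
    from \<open>z\<close> to \<open>y\<close>; the induction hypothesis is applied to it instead of
    \<open>f\<close>.\<close>
  define f' where "f' u = (\<integral>\<^sup>+w. f (u(k := w)) \<partial>F)" for u
  have "(\<lambda>(u, w). f (u(k := w))) \<in> borel_measurable (seq_space \<Otimes>\<^sub>M F)"
    using measurable_compose[OF measurable_update_seq[of k] Suc.prems]
    by (simp only: split_beta' measurable_cong_sets[OF sets_pair_measure_cong[OF refl sets_F] refl])
  then have f' [measurable]: "f' \<in> borel_measurable seq_space"
    unfolding f'_def by measurable
  have "(\<integral>\<^sup>+y. f (\<lambda>i. if i < Suc k then y i else z i) \<partial>P)
      = (\<integral>\<^sup>+y. f' (\<lambda>i. if i < k then y i else z i) \<partial>P)" for z
  proof -
    have upd: "(\<lambda>i. if i < Suc k then (y(k := w)) i else z i) = (\<lambda>i. if i < k then y i else z i)(k := w)"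
      for y and w :: real
      by (auto simp: fun_eq_iff)
    have "(\<integral>\<^sup>+y. f (\<lambda>i. if i < Suc k then y i else z i) \<partial>P)
        = (\<integral>\<^sup>+y. \<integral>\<^sup>+w. f (\<lambda>i. if i < Suc k then (y(k := w)) i else z i) \<partial>F \<partial>P)"
      by (rule nn_integral_P_update[OF measurable_compose[OF measurable_splice1 Suc.prems]])
    then show ?thesis
      by (simp only: upd f'_def)
  qed
  then have "(\<integral>\<^sup>+z. \<integral>\<^sup>+y. f (\<lambda>i. if i < Suc k then y i else z i) \<partial>P \<partial>P) = (\<integral>\<^sup>+y. f' y \<partial>P)"
    by (simp only: Suc.IH[OF f'])
  also have "\<dots> = (\<integral>\<^sup>+y. f y \<partial>P)"
    unfolding f'_def by (rule nn_integral_P_update[OF Suc.prems, symmetric])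
  finally show ?case .
qed

text \<open>The appended block can be read off a full i.i.d. sequence \<open>z\<close>, whose
  coordinates in \<open>{k..<m}\<close> have the required product law. For \<open>m \<le> k\<close>
  no coordinate of \<open>z\<close> is read.\<close>

lemma nn_integral_resize:
  assumes h: "h \<in> borel_measurable seq_space"
  shows "(\<integral>\<^sup>+x. h x \<partial>resize F (k, restrict y {..<k}) m)
    = (\<integral>\<^sup>+z. h (restrict (\<lambda>i. if i < k then y i else z i) {..<m}) \<partial>P)"
proof -
  let ?D = "Pi\<^sub>M {k..<m} (\<lambda>_. F)"
  let ?r = "\<lambda>z. \<lambda>i\<in>{..<m}. if i < k then restrict y {..<k} i else z i"
  have [measurable]: "?r \<in> ?D \<rightarrow>\<^sub>M seq_space"
    unfolding restrict_def
  proof (rule measurable_abs_UNIV)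
    fix i
    show "(\<lambda>z. if i \<in> {..<m} then if i < k then if i \<in> {..<k} then y i else undefined else z i else undefined)
         \<in> borel_measurable ?D"
      by (cases "i < m"; cases "i < k") auto
  qed
  have "(\<integral>\<^sup>+x. h x \<partial>resize F (k, restrict y {..<k}) m) = (\<integral>\<^sup>+z. h (?r z) \<partial>?D)"
    unfolding resize_def using h by (simp add: nn_integral_distr)
  also have "\<dots> = (\<integral>\<^sup>+z. h (?r z) \<partial>distr P ?D (\<lambda>z. restrict z {k..<m}))"
    by (subst P.distr_PiM_restrict_finite) auto
  also have "\<dots> = (\<integral>\<^sup>+z. h (?r (restrict z {k..<m})) \<partial>P)"
    using h by (intro nn_integral_distr) (auto intro!: measurable_restrict_subset)
  also have "(\<lambda>z. ?r (restrict z {k..<m})) = (\<lambda>z. restrict (\<lambda>i. if i < k then y i else z i) {..<m})"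
    by (auto simp: fun_eq_iff restrict_def)
  finally show ?thesis .
qed

text \<open>Fresh coordinates beyond \<open>k\<close> leave the weight \<open>G\<close> unchanged
  and turn \<open>y\<close> into a spliced i.i.d. sequence. Appending samples therefore amounts to
  revealing further coordinates of one sequence.\<close>

lemma nn_integral_resize_P:
  assumes h: "h \<in> borel_measurable seq_space" and G: "G \<in> borel_measurable seq_space"
    and local: "\<And>y y'. (\<And>i. i < k \<Longrightarrow> y i = y' i) \<Longrightarrow> G y = G y'"
  shows "(\<integral>\<^sup>+y. (\<integral>\<^sup>+x. h x \<partial>resize F (k, restrict y {..<k}) m) * G y \<partial>P)
    = (\<integral>\<^sup>+y. h (restrict y {..<m}) * G y \<partial>P)"
proof -
  interpret PP: pair_sigma_finite P P by (rule pair_sigma_finite_PP)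
  let ?s = "\<lambda>y z i. if i < k then y i else z i"
  define f where "f y = h (restrict y {..<m}) * G y" for y
  note [measurable] = h G
  have f [measurable]: "f \<in> borel_measurable seq_space"
    unfolding f_def by measurable
  have fs: "(\<lambda>(y, z). f (?s y z)) \<in> borel_measurable (P \<Otimes>\<^sub>M P)"
    using measurable_compose[OF measurable_splice f]
    by (simp only: split_beta' measurable_cong_sets[OF sets_pair_measure_cong[OF sets_P sets_P] refl])
  have "(\<integral>\<^sup>+y. (\<integral>\<^sup>+x. h x \<partial>resize F (k, restrict y {..<k}) m) * G y \<partial>P)
      = (\<integral>\<^sup>+y. \<integral>\<^sup>+z. f (?s y z) \<partial>P \<partial>P)"
  proof (rule nn_integral_cong)
    fix y
    have "(\<lambda>z. h (restrict (?s y z) {..<m})) \<in> borel_measurable P"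
      using measurable_compose[OF measurable_compose[OF measurable_splice2 measurable_restrict_seq] h]
      by (simp add: measurable_cong_sets[OF sets_P refl])
    then have "(\<integral>\<^sup>+z. h (restrict (?s y z) {..<m}) \<partial>P) * G y = (\<integral>\<^sup>+z. h (restrict (?s y z) {..<m}) * G y \<partial>P)"
      by (rule nn_integral_multc[symmetric])
    moreover have "G y = G (?s y z)" for z
      by (rule local) simp
    ultimately show "(\<integral>\<^sup>+x. h x \<partial>resize F (k, restrict y {..<k}) m) * G y = (\<integral>\<^sup>+z. f (?s y z) \<partial>P)"
      by (simp only: nn_integral_resize[OF h] f_def)
  qed
  also have "\<dots> = (\<integral>\<^sup>+z. \<integral>\<^sup>+y. f (?s y z) \<partial>P \<partial>P)"
    by (rule PP.Fubini'[OF fs, symmetric])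
  also have "\<dots> = (\<integral>\<^sup>+y. f y \<partial>P)"
    by (rule nn_integral_P_splice[OF f])
  finally show ?thesis by (simp only: f_def)
qed

lemma first_passage_restrict:
  "first_passage a (k, restrict y {..<k}) = (LEAST j. j \<le> k \<and> (\<Sum>i<j. y i) > a)"
proof -
  have "(\<Sum>i<j. restrict y {..<k} i) = (\<Sum>i<j. y i)" if "j \<le> k" for j
    using that by (intro sum.cong) auto
  then show ?thesis
    by (auto simp: first_passage_def intro!: arg_cong[where f=Least])
qed

lemma AE_P_nonneg: "AE y in P. \<forall>i. 0 \<le> y i"
  using P.AE_component[OF _ nonneg] by (simp add: AE_all_countable)

text \<open>Given the infinite sequence \<open>y\<close>, the conditional law of the length is \<open>\<nu>\<close> conditioned on
  exceeding the first passage index, which is exactly the law the chain redraws the length from.\<close>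

lemma nn_integral_redraw_length:
  assumes "\<And>i. 0 \<le> y i"
  shows "(\<integral>\<^sup>+k. (\<integral>\<^sup>+m. C m \<partial>cond_law \<nu> {first_passage a (k, restrict y {..<k})..})
      * indicator {k. (\<Sum>i<k. y i) > a} k \<partial>\<nu>) = (\<integral>\<^sup>+m. C m * indicator {m. (\<Sum>i<m. y i) > a} m \<partial>\<nu>)"
proof (cases "\<exists>j. (\<Sum>i<j. y i) > a")
  case False
  \<comment> \<open>If no partial sum exceeds \<open>a\<close>, both indicators vanish
    identically.\<close>
  then show ?thesis by simp
next
  case True
  \<comment> \<open>The passage index of the whole sequence, which unlike
    \<open>first_passage\<close> involves no bound by the current length.\<close>
  define \<tau> where "\<tau> = (LEAST j. (\<Sum>i<j. y i) > a)"
  have \<tau>: "(\<Sum>i<\<tau>. y i) > a"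
    unfolding \<tau>_def using True by (rule LeastI_ex)
  \<comment> \<open>Nonnegative summands make the partial sums monotone, so the admissible lengths
    are exactly those from \<tau> on.\<close>
  have iff: "(\<Sum>i<k. y i) > a \<longleftrightarrow> \<tau> \<le> k" for k
  proof
    show "\<tau> \<le> k" if "(\<Sum>i<k. y i) > a"
      unfolding \<tau>_def using that by (rule Least_le)
    assume "\<tau> \<le> k"
    then have "(\<Sum>i<\<tau>. y i) \<le> (\<Sum>i<k. y i)"
      using assms by (intro sum_mono2) auto
    with \<tau> show "(\<Sum>i<k. y i) > a" by simp
  qed
  \<comment> \<open>On the event for the sum the passage index is visible in the truncated vector,
    so the law of the new length is the same for all such \<open>k\<close>.\<close>
  have fp: "first_passage a (k, restrict y {..<k}) = \<tau>" if "\<tau> \<le> k" for k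
    unfolding first_passage_restrict using that by (intro Least_equality) (auto simp: iff)
  have "(\<integral>\<^sup>+k. (\<integral>\<^sup>+m. C m \<partial>cond_law \<nu> {first_passage a (k, restrict y {..<k})..})
      * indicator {k. (\<Sum>i<k. y i) > a} k \<partial>\<nu>)
      = (\<integral>\<^sup>+k. (\<integral>\<^sup>+m. C m \<partial>cond_law \<nu> {\<tau>..}) * indicator {\<tau>..} k \<partial>\<nu>)"
    by (intro nn_integral_cong) (auto simp: iff fp indicator_def)
  also have "\<dots> = emeasure \<nu> {\<tau>..} * (\<integral>\<^sup>+m. C m \<partial>cond_law \<nu> {\<tau>..})"
    by (subst nn_integral_cmult_indicator) (simp_all add: sets_\<nu> mult.commute)
  also have "\<dots> = (\<integral>\<^sup>+m. C m * indicator {\<tau>..} m \<partial>\<nu>)"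
    by (rule nn_integral_cond_law[OF prob_\<nu>])
      (simp_all add: sets_\<nu> measurable_cong_sets[OF sets_\<nu> refl])
  also have "{\<tau>..} = {m. (\<Sum>i<m. y i) > a}"
    by (auto simp: iff)
  finally show ?thesis .
qed

text \<open>First, for fixed \<open>k\<close>, the resized vector is replaced by the truncation of
  \<open>y\<close> itself. Then the order of integration is exchanged, and for fixed
  \<open>y\<close> only the length is redrawn, from its conditional law given the sequence.\<close>

lemma nn_integral_resize_invariant:
  assumes h: "\<And>m. h m \<in> borel_measurable seq_space"
  shows "(\<integral>\<^sup>+k. \<integral>\<^sup>+y. (\<integral>\<^sup>+m. \<integral>\<^sup>+x. h m x \<partial>resize F (k, restrict y {..<k}) m
        \<partial>cond_law \<nu> {first_passage a (k, restrict y {..<k})..}) * indicator {y. (\<Sum>i<k. y i) > a} y \<partial>P \<partial>\<nu>)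
    = (\<integral>\<^sup>+k. \<integral>\<^sup>+y. h k (restrict y {..<k}) * indicator {y. (\<Sum>i<k. y i) > a} y \<partial>P \<partial>\<nu>)"
proof -
  interpret \<nu>P: pair_sigma_finite \<nu> P ..
  let ?fp = "\<lambda>k y. first_passage a (k, restrict y {..<k})"
  let ?S = "\<lambda>k. {y. (\<Sum>i<k. y i) > a}"
  define w where "w j m = emeasure (cond_law \<nu> {j..}) {m}" for j m
  \<comment> \<open>The average over the new length once the appended samples have been identified
    with the coordinates of \<open>y\<close>.\<close>
  define C where "C k y = (\<integral>\<^sup>+m. h m (restrict y {..<m}) \<partial>cond_law \<nu> {?fp k y..})" for k y
  have suminf: "(\<integral>\<^sup>+m. f m \<partial>cond_law \<nu> {j..}) = (\<Sum>m. f m * w j m)" for f j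
    unfolding w_def by (rule nn_integral_nat_eq_suminf) (simp add: sets_\<nu>)
  note [measurable] = h
  have fp: "?fp k \<in> seq_space \<rightarrow>\<^sub>M count_space UNIV" for k
    by (rule measurable_compose[OF _ measurable_first_passage]) measurable
  have [measurable]: "(\<lambda>y. w (?fp k y) m) \<in> borel_measurable seq_space" for k m
    by (rule measurable_compose[OF fp]) simp
  have h' [measurable]: "(\<lambda>y. h m (restrict y {..<m})) \<in> borel_measurable seq_space" for m
    by measurable
  have res [measurable]: "(\<lambda>y. \<integral>\<^sup>+x. h m x \<partial>resize F (k, restrict y {..<k}) m) \<in> borel_measurable seq_space" for k m
    by (rule measurable_compose[OF _ nn_integral_measurable_subprob_algebra2[OF _ measurable_resize]])
      measurable
  have C [measurable]: "C k \<in> borel_measurable seq_space" for k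
    unfolding C_def suminf by measurable
  have fixed_k: "(\<integral>\<^sup>+y. (\<integral>\<^sup>+m. \<integral>\<^sup>+x. h m x \<partial>resize F (k, restrict y {..<k}) m \<partial>cond_law \<nu> {?fp k y..})
        * indicator (?S k) y \<partial>P) = (\<integral>\<^sup>+y. C k y * indicator (?S k) y \<partial>P)" for k
  proof -
    define G where "G m y = w (?fp k y) m * indicator (?S k) y" for m y
    have G [measurable]: "G m \<in> borel_measurable seq_space" for m
      unfolding G_def by measurable
    \<comment> \<open>The passage index of the truncated vector and the event for the sum read only
      the first \<open>k\<close> coordinates, as the resizing identity demands.\<close>
    have local: "G m y = G m y'" if "\<And>i. i < k \<Longrightarrow> y i = y' i" for m y y'
    proof -
      have "restrict y {..<k} = restrict y' {..<k}"
        using that by (auto simp: restrict_def)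
      moreover have "(\<Sum>i<k. y i) = (\<Sum>i<k. y' i)"
        using that by (intro sum.cong) auto
      ultimately show ?thesis by (simp add: G_def indicator_def)
    qed
    have "(\<integral>\<^sup>+y. (\<integral>\<^sup>+m. \<integral>\<^sup>+x. h m x \<partial>resize F (k, restrict y {..<k}) m \<partial>cond_law \<nu> {?fp k y..})
        * indicator (?S k) y \<partial>P)
      = (\<integral>\<^sup>+y. (\<Sum>m. (\<integral>\<^sup>+x. h m x \<partial>resize F (k, restrict y {..<k}) m) * G m y) \<partial>P)"
      by (simp only: suminf ennreal_suminf_multc[symmetric] G_def mult.assoc)
    also have "\<dots> = (\<Sum>m. \<integral>\<^sup>+y. (\<integral>\<^sup>+x. h m x \<partial>resize F (k, restrict y {..<k}) m) * G m y \<partial>P)"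
      by (rule nn_integral_suminf) measurable
    also have "\<dots> = (\<Sum>m. \<integral>\<^sup>+y. h m (restrict y {..<m}) * G m y \<partial>P)"
      by (simp only: nn_integral_resize_P[OF h G local])
    also have "\<dots> = (\<integral>\<^sup>+y. (\<Sum>m. h m (restrict y {..<m}) * G m y) \<partial>P)"
      by (rule nn_integral_suminf[symmetric]) measurable
    also have "\<dots> = (\<integral>\<^sup>+y. C k y * indicator (?S k) y \<partial>P)"
      by (simp only: C_def suminf ennreal_suminf_multc[symmetric] G_def mult.assoc)
    finally show ?thesis .
  qed
  have joint: "(\<lambda>(k, y). f k y) \<in> borel_measurable (\<nu> \<Otimes>\<^sub>M P)"
    if [measurable]: "\<And>k. f k \<in> borel_measurable seq_space" for f :: "nat \<Rightarrow> (nat \<Rightarrow> real) \<Rightarrow> ennreal"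
  proof -
    have "(\<lambda>(k, y). f k y) \<in> borel_measurable (count_space UNIV \<Otimes>\<^sub>M seq_space)"
      by (rule measurable_pair_measure_countable1) simp_all
    then show ?thesis
      by (simp only: measurable_cong_sets[OF sets_pair_measure_cong[OF sets_\<nu> sets_P] refl])
  qed
  have "(\<integral>\<^sup>+k. \<integral>\<^sup>+y. C k y * indicator (?S k) y \<partial>P \<partial>\<nu>) = (\<integral>\<^sup>+y. \<integral>\<^sup>+k. C k y * indicator (?S k) y \<partial>\<nu> \<partial>P)"
    by (rule \<nu>P.Fubini'[symmetric], rule joint) measurable
  \<comment> \<open>The redrawing identity holds for nonnegative sequences, which is almost every
    sequence under \<open>P\<close>.\<close>
  also have "\<dots> = (\<integral>\<^sup>+y. \<integral>\<^sup>+k. h k (restrict y {..<k}) * indicator (?S k) y \<partial>\<nu> \<partial>P)"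
  proof (rule nn_integral_cong_AE)
    show "AE y in P. (\<integral>\<^sup>+k. C k y * indicator (?S k) y \<partial>\<nu>)
        = (\<integral>\<^sup>+k. h k (restrict y {..<k}) * indicator (?S k) y \<partial>\<nu>)"
      using AE_P_nonneg
    proof (eventually_elim)
      case (elim y)
      then have "0 \<le> y i" for i by simp
      from nn_integral_redraw_length[OF this, where C="\<lambda>m. h m (restrict y {..<m})" and a=a]
      show ?case by (simp add: C_def indicator_def)
    qed
  qed
  also have "\<dots> = (\<integral>\<^sup>+k. \<integral>\<^sup>+y. h k (restrict y {..<k}) * indicator (?S k) y \<partial>P \<partial>\<nu>)"
    by (rule \<nu>P.Fubini', rule joint) measurable
  finally show ?thesis by (simp only: fixed_k)
qed

text \<open>Stationarity before normalisation. The length step is undone first, with the refresh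
  probability as test function, and then the refresh step for each fixed length.\<close>

lemma nn_integral_chain_kernel_invariant:
  assumes B [measurable]: "B \<in> sets state_space"
  shows "(\<integral>\<^sup>+k. \<integral>\<^sup>+y. emeasure (chain_kernel F \<nu> a (k, restrict y {..<k})) B * indicator {y. (\<Sum>i<k. y i) > a} y \<partial>P \<partial>\<nu>)
    = (\<integral>\<^sup>+k. \<integral>\<^sup>+y. indicator B (k, restrict y {..<k}) * indicator {y. (\<Sum>i<k. y i) > a} y \<partial>P \<partial>\<nu>)"
  unfolding emeasure_chain_kernel[OF B]
  by (subst nn_integral_resize_invariant) (measurable, simp only: nn_integral_refresh_invariant[OF B])

end

section \<open>The events for the sum and the maximum on states\<close>

lemma sum_exceeds_restrict [simp]:
  "sum_exceeds a (k, restrict y {..<k}) \<longleftrightarrow> (\<Sum>i<k. y i) > a"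
proof -
  have "(\<Sum>i<k. restrict y {..<k} i) = (\<Sum>i<k. y i)"
    by (intro sum.cong) auto
  then show ?thesis by (simp add: sum_exceeds_def)
qed

lemma max_exceeds_iff: "max_exceeds a (k, y) \<longleftrightarrow> (\<exists>i<k. y i > a)"
  by (auto simp: max_exceeds_def Max_gr_iff lessThan_empty_iff)

lemma pred_sum_exceeds [measurable]: "Measurable.pred state_space (sum_exceeds a)"
  by (rule measurable_pair_measure_countable1) (simp_all add: sum_exceeds_def)

lemma pred_max_exceeds [measurable]: "Measurable.pred state_space (max_exceeds a)"
  by (rule measurable_pair_measure_countable1) (simp_all add: max_exceeds_iff)

subsection \<open>Stationary chains and the variance bound\<close>

text \<open>Taking the full path space as the past event in \<open>markov_chain\<close> leaves a
  one-step relation between consecutive marginals, along which invariance carries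
  \<open>\<pi>\<close> forward.\<close>

lemma stationary_marginals:
  assumes chain: "markov_chain Q S K \<pi> X" and K [measurable]: "K \<in> S \<rightarrow>\<^sub>M subprob_algebra S"
    and inv: "\<And>B. B \<in> sets S \<Longrightarrow> (\<integral>\<^sup>+s. emeasure (K s) B \<partial>\<pi>) = emeasure \<pi> B"
  shows "distr Q S (X t) = \<pi>"
proof (induction t)
  case 0
  show ?case
    using chain by (simp add: markov_chain_def)
next
  case (Suc t)
  interpret Q: prob_space Q
    using chain by (simp add: markov_chain_def)
  have X [measurable]: "X t \<in> Q \<rightarrow>\<^sub>M S" for t
    using chain by (simp add: markov_chain_def)
  show ?case
  proof (rule measure_eqI)
    show "sets (distr Q S (X (Suc t))) = sets \<pi>"
      using Suc by (metis sets_distr)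
    fix B assume "B \<in> sets (distr Q S (X (Suc t)))"
    then have B [measurable]: "B \<in> sets S" by simp
    \<comment> \<open>The trivial past event; its indicator is constantly 1 along the paths.\<close>
    let ?A = "space (Pi\<^sub>M {..t} (\<lambda>_. S))"
    have A: "(\<lambda>i\<in>{..t}. X i \<omega>) \<in> ?A" if "\<omega> \<in> space Q" for \<omega>
      using that measurable_space[OF X] by (auto simp: space_PiM)
    have KX: "subprob_space (K (X t \<omega>))" if "\<omega> \<in> space Q" for \<omega>
      using that measurable_space[OF X] by (intro subprob_space_kernel[OF K]) auto
    have "Q.prob {\<omega> \<in> space Q. X (Suc t) \<omega> \<in> B}
        = \<P>(\<omega> in Q. (\<lambda>i\<in>{..t}. X i \<omega>) \<in> ?A \<and> X (Suc t) \<omega> \<in> B)"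
      using A by (intro arg_cong[where f=Q.prob]) auto
    also have "\<dots> = (\<integral>\<omega>. indicator ?A (\<lambda>i\<in>{..t}. X i \<omega>) * measure (K (X t \<omega>)) B \<partial>Q)"
      using chain B unfolding markov_chain_def by blast
    also have "\<dots> = (\<integral>\<omega>. measure (K (X t \<omega>)) B \<partial>Q)"
      using A by (intro Bochner_Integration.integral_cong) auto
    finally have prob_eq: "Q.prob {\<omega> \<in> space Q. X (Suc t) \<omega> \<in> B} = (\<integral>\<omega>. measure (K (X t \<omega>)) B \<partial>Q)" .
    have "emeasure (distr Q S (X (Suc t))) B = ennreal (Q.prob {\<omega> \<in> space Q. X (Suc t) \<omega> \<in> B})"
      by (simp add: emeasure_distr Q.emeasure_eq_measure vimage_def Int_def conj_commute)
    also have "\<dots> = (\<integral>\<^sup>+\<omega>. ennreal (measure (K (X t \<omega>)) B) \<partial>Q)"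
      unfolding prob_eq
    proof (rule nn_integral_eq_integral[symmetric])
      show "integrable Q (\<lambda>\<omega>. measure (K (X t \<omega>)) B)"
        using KX by (intro Q.integrable_const_bound[where B=1])
          (auto intro!: AE_I2 subprob_space.subprob_measure_le_1)
    qed simp
    also have "\<dots> = (\<integral>\<^sup>+\<omega>. emeasure (K (X t \<omega>)) B \<partial>Q)"
      using KX by (intro nn_integral_cong)
        (simp add: finite_measure.emeasure_eq_measure subprob_space_def)
    also have "\<dots> = (\<integral>\<^sup>+s. emeasure (K s) B \<partial>distr Q S (X t))"
      by (subst nn_integral_distr) simp_all
    also have "\<dots> = emeasure \<pi> B"
      unfolding Suc by (rule inv[OF B])
    finally show "emeasure (distr Q S (X (Suc t))) B = emeasure \<pi> B" .
  qed
qed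

text \<open>An average of indicators with common mean \<open>r\<close> takes values in \<open>[0, 1]\<close>, so its second moment is at most \<open>r\<close>.\<close>

lemma (in prob_space) variance_average_indicators_le:
  fixes A :: "nat \<Rightarrow> 'a \<Rightarrow> bool"
  assumes A [measurable]: "\<And>t. Measurable.pred M (A t)"
    and r: "\<And>t. prob {\<omega> \<in> space M. A t \<omega>} = r" and T: "T \<ge> 1"
  shows "variance (\<lambda>\<omega>. c * (1 / real T * (\<Sum>t<T. of_bool (A t \<omega>)))) \<le> c\<^sup>2 * (r * (1 - r))"
proof -
  define W :: "'a \<Rightarrow> real" where "W \<omega> = 1 / real T * (\<Sum>t<T. of_bool (A t \<omega>))" for \<omega>
  have [measurable]: "W \<in> borel_measurable M"
    unfolding W_def of_bool_def by measurable
  have W: "0 \<le> W \<omega>" "W \<omega> \<le> 1" for \<omega>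
  proof -
    show "0 \<le> W \<omega>"
      unfolding W_def by (intro mult_nonneg_nonneg sum_nonneg) auto
    have "(\<Sum>t<T. of_bool (A t \<omega>)) \<le> (\<Sum>t<T. 1 :: real)"
      by (intro sum_mono) auto
    with T show "W \<omega> \<le> 1"
      by (simp add: W_def field_simps)
  qed
  have int_W: "integrable M W"
    using W by (intro integrable_const_bound[where B=1]) auto
  have int_W2: "integrable M (\<lambda>\<omega>. (W \<omega>)\<^sup>2)"
    using W by (intro integrable_const_bound[where B=1]) (auto simp: power_le_one)
  have ind: "(\<lambda>\<omega>. of_bool (A t \<omega>)) = (indicator {\<omega>. A t \<omega>} :: 'a \<Rightarrow> real)" for t
    by (auto simp: fun_eq_iff)
  have EA: "expectation (\<lambda>\<omega>. of_bool (A t \<omega>)) = r" for t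
    unfolding ind using r[of t] by (simp add: Int_def conj_commute)
  have "expectation W = 1 / real T * (\<Sum>t<T. expectation (\<lambda>\<omega>. of_bool (A t \<omega>)))"
    unfolding W_def by (subst integral_mult_right_zero, subst Bochner_Integration.integral_sum)
      (auto intro!: integrable_const_bound[where B=1] simp: of_bool_def)
  also have "\<dots> = r"
    using T by (simp add: EA)
  finally have EW: "expectation W = r" .
  have "expectation (\<lambda>\<omega>. (W \<omega>)\<^sup>2) \<le> expectation W"
    using W by (intro integral_mono int_W int_W2) (auto simp: power2_eq_square mult_left_le_one_le)
  then have "c\<^sup>2 * (expectation (\<lambda>\<omega>. (W \<omega>)\<^sup>2) - r\<^sup>2) \<le> c\<^sup>2 * (r * (1 - r))"
    by (intro mult_left_mono) (auto simp: EW power2_eq_square algebra_simps)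
  moreover have "variance (\<lambda>\<omega>. c * W \<omega>) = c\<^sup>2 * (expectation (\<lambda>\<omega>. (W \<omega>)\<^sup>2) - r\<^sup>2)"
    using int_W int_W2 by (subst variance_eq) (auto simp: power_mult_distrib EW algebra_simps)
  ultimately show ?thesis
    unfolding W_def by simp
qed

section \<open>The random vector and its law on lengths and sequences\<close>

text \<open>The setting for one fixed index of the limit, with a single length variable
  \<open>N\<close>. All bounds are proved here before any limit is taken.\<close>

locale compound_sum = prob_space M for M :: "'w measure" +
  fixes N :: "'w \<Rightarrow> nat" and Y :: "nat \<Rightarrow> 'w \<Rightarrow> real"
  assumes indep_Y: "indep_vars (\<lambda>_. borel) Y UNIV"
    and Y_nonneg: "\<And>i. AE \<omega> in M. 0 \<le> Y i \<omega>"
    and Y_ident: "\<And>i. distr M borel (Y i) = distr M borel (Y 0)"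
    and N [measurable]: "N \<in> M \<rightarrow>\<^sub>M count_space UNIV"
    and indep_N: "indep_set
           (sets (vimage_algebra (space M) N (count_space UNIV)))
           (sets (vimage_algebra (space M) (\<lambda>\<omega> i. Y i \<omega>) seq_space))"
begin

abbreviation F :: "real measure" where "F \<equiv> distr M borel (Y 0)"
abbreviation \<nu> :: "nat measure" where "\<nu> \<equiv> distr M (count_space UNIV) N"

lemma Y [measurable]: "Y i \<in> borel_measurable M"
  using indep_Y by (simp add: indep_vars_def)

sublocale S: sampler F \<nu>
proof (rule sampler.intro)
  show "prob_space F" "prob_space \<nu>"
    by (rule prob_space_distr, measurable)+
  show "AE z in F. 0 \<le> z"
    using Y_nonneg[of 0] by (subst AE_distr_iff) auto
qed auto

lemma measurable_Y_seq [measurable]: "(\<lambda>\<omega> i. Y i \<omega>) \<in> M \<rightarrow>\<^sub>M seq_space"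
  by (rule measurable_abs_UNIV) measurable

lemma distr_Y_seq: "distr M seq_space (\<lambda>\<omega> i. Y i \<omega>) = S.P"
proof -
  have "distr M seq_space (\<lambda>\<omega> i. Y i \<omega>) = Pi\<^sub>M UNIV (\<lambda>i. distr M borel (Y i))"
    using indep_Y indep_vars_iff_distr_eq_PiM[where I=UNIV and M'="\<lambda>_. borel" and X=Y]
    by (simp add: restrict_UNIV)
  also have "(\<lambda>i. distr M borel (Y i)) = (\<lambda>_. F)"
    by (intro ext Y_ident)
  finally show ?thesis .
qed

text \<open>Independence gives the product formula on measurable rectangles, and these determine the
  product measure.\<close>

lemma joint_law:
  "\<nu> \<Otimes>\<^sub>M S.P = distr M state_space (\<lambda>\<omega>. (N \<omega>, \<lambda>i. Y i \<omega>))"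
proof (rule pair_measure_eqI)
  fix A B assume "A \<in> sets \<nu>" and "B \<in> sets S.P"
  then have B [measurable]: "B \<in> sets seq_space"
    by (simp add: S.sets_P)
  have A [measurable]: "A \<in> sets (count_space UNIV)" by simp
  let ?Y = "\<lambda>\<omega> i. Y i \<omega>"
  have "prob ((N -` A \<inter> space M) \<inter> (?Y -` B \<inter> space M)) = prob (N -` A \<inter> space M) * prob (?Y -` B \<inter> space M)"
    by (intro indep_setD[OF indep_N] in_vimage_algebra A B)
  moreover have "(N -` A \<inter> space M) \<inter> (?Y -` B \<inter> space M) = (\<lambda>\<omega>. (N \<omega>, ?Y \<omega>)) -` (A \<times> B) \<inter> space M"
    by auto
  ultimately show "emeasure \<nu> A * emeasure S.P B
      = emeasure (distr M state_space (\<lambda>\<omega>. (N \<omega>, ?Y \<omega>))) (A \<times> B)"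
    unfolding distr_Y_seq[symmetric]
    by (simp add: emeasure_distr emeasure_eq_measure ennreal_mult)
qed (auto simp: S.sets_P S.\<nu>.sigma_finite_measure_axioms S.P.sigma_finite_measure_axioms
      intro!: sets_pair_measure_cong)

lemma random_vector_eq:
  "random_vector N Y \<omega> = (N \<omega>, restrict (\<lambda>i. Y i \<omega>) {..<N \<omega>})"
  by (simp add: random_vector_def restrict_def)

lemma measurable_truncate: "(\<lambda>(k, y). (k, restrict y {..<k})) \<in> state_space \<rightarrow>\<^sub>M state_space"
  by (rule measurable_pair_measure_countable1) simp_all

lemma measurable_random_vector [measurable]: "random_vector N Y \<in> M \<rightarrow>\<^sub>M state_space"
proof -
  have "(\<lambda>\<omega>. (N \<omega>, \<lambda>i. Y i \<omega>)) \<in> M \<rightarrow>\<^sub>M state_space" by measurable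
  from measurable_compose[OF this measurable_truncate] show ?thesis
    by (simp add: random_vector_eq[abs_def])
qed

text \<open>The random vector is the truncation of the pair of length and infinite sequence. This
  translates integrals over \<open>M\<close> into the iterated integrals for which invariance was
  proved.\<close>

lemma nn_integral_random_vector:
  assumes \<Phi>: "\<Phi> \<in> borel_measurable state_space"
  shows "(\<integral>\<^sup>+\<omega>. \<Phi> (random_vector N Y \<omega>) \<partial>M) = (\<integral>\<^sup>+k. \<integral>\<^sup>+y. \<Phi> (k, restrict y {..<k}) \<partial>S.P \<partial>\<nu>)"
proof -
  define \<Psi> where "\<Psi> s = \<Phi> (case s of (k, y) \<Rightarrow> (k, restrict y {..<k}))" for s
  have \<Psi> [measurable]: "\<Psi> \<in> borel_measurable state_space"
    unfolding \<Psi>_def by (rule measurable_compose[OF measurable_truncate \<Phi>])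
  then have \<Psi>': "\<Psi> \<in> borel_measurable (\<nu> \<Otimes>\<^sub>M S.P)"
    by (simp only: joint_law measurable_distr_eq1)
  have "(\<integral>\<^sup>+\<omega>. \<Phi> (random_vector N Y \<omega>) \<partial>M) = (\<integral>\<^sup>+s. \<Psi> s \<partial>distr M state_space (\<lambda>\<omega>. (N \<omega>, \<lambda>i. Y i \<omega>)))"
    by (subst nn_integral_distr) (simp_all add: \<Psi>_def random_vector_eq)
  also have "\<dots> = (\<integral>\<^sup>+k. \<integral>\<^sup>+y. \<Psi> (k, y) \<partial>S.P \<partial>\<nu>)"
    unfolding joint_law[symmetric] by (rule S.P.nn_integral_fst[OF \<Psi>', symmetric])
  finally show ?thesis by (simp add: \<Psi>_def)
qed

section \<open>The target law and its invariance\<close>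

definition exceedance :: "real \<Rightarrow> 'w set" where
  "exceedance a = {\<omega> \<in> space M. sum_exceeds a (random_vector N Y \<omega>)}"

lemma exceedance [measurable]: "exceedance a \<in> sets M"
  unfolding exceedance_def by measurable

lemma nn_integral_target_dist:
  assumes \<Phi> [measurable]: "\<Phi> \<in> borel_measurable state_space"
  shows "(\<integral>\<^sup>+s. \<Phi> s \<partial>target_dist M N Y a)
    = (\<integral>\<^sup>+k. \<integral>\<^sup>+y. \<Phi> (k, restrict y {..<k}) * indicator {y. (\<Sum>i<k. y i) > a} y \<partial>S.P \<partial>\<nu>) / emeasure M (exceedance a)"
proof -
  have "(\<integral>\<^sup>+s. \<Phi> s \<partial>target_dist M N Y a) = (\<integral>\<^sup>+\<omega>. \<Phi> (random_vector N Y \<omega>) * indicator (exceedance a) \<omega> \<partial>M) / emeasure M (exceedance a)"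
    unfolding target_dist_def exceedance_def[symmetric]
    by (simp add: nn_integral_distr nn_integral_uniform_measure)
  also have "(\<integral>\<^sup>+\<omega>. \<Phi> (random_vector N Y \<omega>) * indicator (exceedance a) \<omega> \<partial>M)
      = (\<integral>\<^sup>+\<omega>. \<Phi> (random_vector N Y \<omega>) * indicator {s. sum_exceeds a s} (random_vector N Y \<omega>) \<partial>M)"
    by (intro nn_integral_cong) (auto simp: exceedance_def indicator_def)
  also have "\<dots> = (\<integral>\<^sup>+k. \<integral>\<^sup>+y. \<Phi> (k, restrict y {..<k}) * indicator {s. sum_exceeds a s} (k, restrict y {..<k}) \<partial>S.P \<partial>\<nu>)"
    by (rule nn_integral_random_vector) measurable
  finally show ?thesis by (simp add: indicator_def)
qed

text \<open>Both sides carry the same normalising factor, so the claim reduces to the unnormalised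
  invariance on the product space.\<close>

lemma target_dist_invariant:
  assumes B [measurable]: "B \<in> sets state_space"
  shows "(\<integral>\<^sup>+s. emeasure (chain_kernel F \<nu> a s) B \<partial>target_dist M N Y a) = emeasure (target_dist M N Y a) B"
proof -
  note [measurable] = S.measurable_chain_kernel
  have "emeasure (target_dist M N Y a) B = (\<integral>\<^sup>+s. indicator B s \<partial>target_dist M N Y a)"
    by (simp add: target_dist_def)
  then show ?thesis
    by (simp add: nn_integral_target_dist S.nn_integral_chain_kernel_invariant)
qed

section \<open>Exceedance by the maximum and the variance for one index\<close>

text \<open>A sum of nonnegative terms dominates each of its terms.\<close>

lemma AE_max_exceeds_imp_sum_exceeds:
  "AE \<omega> in M. max_exceeds a (random_vector N Y \<omega>) \<longrightarrow> sum_exceeds a (random_vector N Y \<omega>)"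
proof -
  have "AE \<omega> in M. \<forall>i. 0 \<le> Y i \<omega>"
    using Y_nonneg by (simp add: AE_all_countable)
  then show ?thesis
  proof (eventually_elim)
    case (elim \<omega>)
    have "a < (\<Sum>i<N \<omega>. Y i \<omega>)" if "j < N \<omega>" "a < Y j \<omega>" for j
      using that elim member_le_sum[of j "{..<N \<omega>}" "\<lambda>i. Y i \<omega>"] by auto
    then show ?case
      by (auto simp: random_vector_eq max_exceeds_iff)
  qed
qed

lemma prob_max_exceeds_le:
  "\<P>(\<omega> in M. max_exceeds a (random_vector N Y \<omega>)) \<le> \<P>(\<omega> in M. sum_exceeds a (random_vector N Y \<omega>))"
  using AE_max_exceeds_imp_sum_exceeds[of a] by (intro finite_measure_mono_AE) auto

text \<open>The event for the maximum lies almost surely inside the conditioning event, so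
  intersecting with the latter leaves its probability unchanged and the conditional probability is a
  plain quotient.\<close>

lemma measure_target_dist_max_exceeds:
  assumes pos: "\<P>(\<omega> in M. max_exceeds a (random_vector N Y \<omega>)) > 0"
  shows "measure (target_dist M N Y a) {s. max_exceeds a s}
    = \<P>(\<omega> in M. max_exceeds a (random_vector N Y \<omega>)) / \<P>(\<omega> in M. sum_exceeds a (random_vector N Y \<omega>))"
proof -
  let ?B = "{\<omega> \<in> space M. max_exceeds a (random_vector N Y \<omega>)}"
  have [measurable]: "{s. max_exceeds a s} \<in> sets state_space"
    using pred_max_exceeds[of a] by (simp add: pred_def space_pair_measure space_PiM)
  have B: "?B \<in> sets M" by measurable
  have "prob (exceedance a) > 0"
    using pos prob_max_exceeds_le[of a] unfolding exceedance_def by linarith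
  then have E: "emeasure M (exceedance a) \<noteq> 0" "emeasure M (exceedance a) \<noteq> \<infinity>"
    by (simp_all add: emeasure_eq_measure)
  have "AE \<omega> in M. \<omega> \<in> exceedance a \<inter> ?B \<longleftrightarrow> \<omega> \<in> ?B"
    using AE_max_exceeds_imp_sum_exceeds[of a] by eventually_elim (auto simp: exceedance_def)
  then have "prob (exceedance a \<inter> ?B) = prob ?B"
    using B by (intro finite_measure_eq_AE) auto
  then have "measure (uniform_measure M (exceedance a)) ?B = prob ?B / prob (exceedance a)"
    by (simp add: measure_uniform_measure[OF E B])
  moreover have "random_vector N Y -` {s. max_exceeds a s} \<inter> space M = ?B"
    by auto
  ultimately show ?thesis
    unfolding target_dist_def exceedance_def[symmetric]
    by (subst measure_distr) simp_all
qed

text \<open>Given length \<open>k\<close>, all components stay below the threshold with probability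
  \<open>cdf F a ^ k\<close>; for \<open>k = 0\<close> this is 1, in line with the convention for
  the empty maximum. Averaging over the length gives the generating function.\<close>

lemma prob_max_exceeds:
  "\<P>(\<omega> in M. max_exceeds a (random_vector N Y \<omega>)) = 1 - gen_fun M N (cdf F a)"
proof -
  let ?c = "cdf F a"
  have c: "0 \<le> ?c" "?c \<le> 1"
    by (auto simp: cdf_def)
  let ?A = "{\<omega> \<in> space M. \<not> max_exceeds a (random_vector N Y \<omega>)}"
  have "emeasure M ?A = (\<integral>\<^sup>+\<omega>. indicator ?A \<omega> \<partial>M)"
    by (rule nn_integral_indicator[symmetric]) measurable
  also have "\<dots> = (\<integral>\<^sup>+\<omega>. indicator {s. \<not> max_exceeds a s} (random_vector N Y \<omega>) \<partial>M)"
    by (rule nn_integral_cong) (simp add: indicator_def)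
  also have "\<dots> = (\<integral>\<^sup>+k. \<integral>\<^sup>+y. indicator {s. \<not> max_exceeds a s} (k, restrict y {..<k}) \<partial>S.P \<partial>\<nu>)"
    by (rule nn_integral_random_vector) measurable
  also have "\<dots> = (\<integral>\<^sup>+k. ennreal (?c ^ k) \<partial>\<nu>)"
  proof (rule nn_integral_cong)
    fix k
    have "(\<integral>\<^sup>+y. indicator {s. \<not> max_exceeds a s} (k, restrict y {..<k}) \<partial>S.P)
        = (\<integral>\<^sup>+y. indicator {y \<in> space S.P. \<forall>i\<in>{..<k}. y i \<in> {..a}} y \<partial>S.P)"
      by (intro nn_integral_cong) (auto simp: indicator_def max_exceeds_iff not_less)
    also have "\<dots> = emeasure S.P {y \<in> space S.P. \<forall>i\<in>{..<k}. y i \<in> {..a}}"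
      by (intro nn_integral_indicator) measurable
    also have "\<dots> = (\<Prod>i\<in>{..<k}. emeasure F {..a})"
      by (rule S.P.emeasure_PiM_Collect) auto
    also have "\<dots> = ennreal (?c ^ k)"
      by (simp add: cdf_def S.F.emeasure_eq_measure ennreal_power)
    finally show "(\<integral>\<^sup>+y. indicator {s. \<not> max_exceeds a s} (k, restrict y {..<k}) \<partial>S.P) = ennreal (?c ^ k)" .
  qed
  also have "\<dots> = (\<integral>\<^sup>+\<omega>. ennreal (?c ^ N \<omega>) \<partial>M)"
    by (rule nn_integral_distr) simp_all
  also have "\<dots> = ennreal (gen_fun M N ?c)"
    unfolding gen_fun_def using c
    by (intro nn_integral_eq_integral integrable_const_bound[where B=1]) (auto simp: power_le_one)
  finally have "prob {\<omega> \<in> space M. \<not> max_exceeds a (random_vector N Y \<omega>)} = gen_fun M N ?c"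
    using c by (simp add: emeasure_eq_measure gen_fun_def)
  then show ?thesis
    by (subst (asm) prob_neg) simp_all
qed

text \<open>By stationarity each indicator has mean \<open>r = pmax / p\<close>, and the estimator
  has prefactor \<open>1 / pmax\<close>. The bound is
  \<open>(p / pmax)\<^sup>2 * r * (1 - r)\<close>, which simplifies to
  \<open>p / pmax - 1\<close>.\<close>

lemma normalized_variance_bounds:
  fixes Q :: "'b measure" and X :: "nat \<Rightarrow> 'b \<Rightarrow> state" and a :: real and T :: nat
  defines "p \<equiv> \<P>(\<omega> in M. sum_exceeds a (random_vector N Y \<omega>))"
    and "pmax \<equiv> \<P>(\<omega> in M. max_exceeds a (random_vector N Y \<omega>))"
    and "q \<equiv> q_hat (gen_fun M N (cdf F a)) a T X"
  assumes pos: "pmax > 0" and T: "T \<ge> 1"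
    and chain: "markov_chain Q state_space (chain_kernel F \<nu> a) (target_dist M N Y a) X"
  shows "0 \<le> p\<^sup>2 * prob_space.variance Q q" "p\<^sup>2 * prob_space.variance Q q \<le> p / pmax - 1"
proof -
  interpret Q: prob_space Q
    using chain by (simp add: markov_chain_def)
  have X [measurable]: "X t \<in> Q \<rightarrow>\<^sub>M state_space" for t
    using chain by (simp add: markov_chain_def)
  have [measurable]: "{s. max_exceeds a s} \<in> sets state_space"
    using pred_max_exceeds[of a] by (simp add: pred_def space_pair_measure space_PiM)
  have law: "distr Q state_space (X t) = target_dist M N Y a" for t
    by (rule stationary_marginals[OF chain S.measurable_chain_kernel target_dist_invariant])
  have "Q.prob {\<omega> \<in> space Q. max_exceeds a (X t \<omega>)} = measure (distr Q state_space (X t)) {s. max_exceeds a s}" for t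
    by (subst measure_distr) (auto simp: vimage_def Int_def conj_commute)
  then have r: "Q.prob {\<omega> \<in> space Q. max_exceeds a (X t \<omega>)} = pmax / p" for t
    by (simp add: law measure_target_dist_max_exceeds[OF pos[unfolded pmax_def]] p_def pmax_def)
  have "pmax \<le> p"
    unfolding pmax_def p_def by (rule prob_max_exceeds_le)
  with pos have "p \<noteq> 0" by simp
  have "Q.variance q \<le> (1 / pmax)\<^sup>2 * (pmax / p * (1 - pmax / p))"
    unfolding q_def q_hat_def[abs_def] prob_max_exceeds[symmetric] pmax_def[symmetric]
    by (rule Q.variance_average_indicators_le[OF _ r T]) measurable
  then have "p\<^sup>2 * Q.variance q \<le> p\<^sup>2 * ((1 / pmax)\<^sup>2 * (pmax / p * (1 - pmax / p)))"
    by (intro mult_left_mono) auto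
  also have "\<dots> = p / pmax - 1"
    using pos \<open>p \<noteq> 0\<close> by (simp add: field_simps power2_eq_square)
  finally show "p\<^sup>2 * Q.variance q \<le> p / pmax - 1" .
  show "0 \<le> p\<^sup>2 * Q.variance q"
    by (intro mult_nonneg_nonneg integral_nonneg_AE) auto
qed

end

section \<open>Passage to the limit\<close>

theorem theorem4p10:
  fixes M :: "'a measure" and Y :: "nat \<Rightarrow> 'a \<Rightarrow> real" and f_Y :: "real \<Rightarrow> real"
    and N :: "nat \<Rightarrow> 'a \<Rightarrow> nat" and a :: "nat \<Rightarrow> real"
    and Q :: "nat \<Rightarrow> 'b measure" and X :: "nat \<Rightarrow> nat \<Rightarrow> 'b \<Rightarrow> state" and T :: nat
  defines "F \<equiv> distr M borel (Y 0)"
    and "p \<equiv> \<lambda>n. \<P>(\<omega> in M. sum_exceeds (a n) (random_vector (N n) Y \<omega>))"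
    and "pmax \<equiv> \<lambda>n. \<P>(\<omega> in M. max_exceeds (a n) (random_vector (N n) Y \<omega>))"
  assumes "prob_space M"
    and "prob_space.indep_vars M (\<lambda>_. borel) Y UNIV"
    and "\<And>i. AE \<omega> in M. 0 \<le> Y i \<omega>"
    and "\<And>x. 0 \<le> f_Y x"
    and "\<And>i. distributed M lborel (Y i) (\<lambda>x. ennreal (f_Y x))"
    and "\<And>n. N n \<in> M \<rightarrow>\<^sub>M count_space UNIV"
    and "\<And>n. prob_space.indep_set M
           (sets (vimage_algebra (space M) (N n) (count_space UNIV)))
           (sets (vimage_algebra (space M) (\<lambda>\<omega> i. Y i \<omega>) seq_space))"
    and "\<And>n. 0 \<le> a n"
    and "filterlim a at_top sequentially"
    and "\<And>n. pmax n > 0"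
    and "(\<lambda>n. p n / pmax n) \<longlonglongrightarrow> 1"
    and "\<And>n. markov_chain (Q n) state_space
           (chain_kernel F (distr M (count_space UNIV) (N n)) (a n))
           (target_dist M (N n) Y (a n)) (X n)"
    and "T \<ge> 1"
  shows "(\<lambda>n. (p n)\<^sup>2 * prob_space.variance (Q n)
           (q_hat (gen_fun M (N n) (cdf F (a n))) (a n) T (X n))) \<longlonglongrightarrow> 0"
proof -
  interpret prob_space M by (rule assms(4))
  \<comment> \<open>The common density forces all summands to have the same law, which is the
    identical distribution required by \<open>compound_sum\<close>.\<close>
  have density: "distr M borel (Y i) = density lborel (\<lambda>x. ennreal (f_Y x))" for i
  proof -
    have "distr M borel (Y i) = distr M lborel (Y i)"
      by (rule distr_cong) simp_all
    also have "\<dots> = density lborel (\<lambda>x. ennreal (f_Y x))"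
      by (rule distributed_distr_eq_density[OF assms(8)])
    finally show ?thesis .
  qed
  have compound: "compound_sum M (N n) Y" for n
  proof (intro compound_sum.intro compound_sum_axioms.intro)
    show "distr M borel (Y i) = distr M borel (Y 0)" for i
      by (simp only: density)
  qed (rule assms)+
  note bounds = compound_sum.normalized_variance_bounds[OF compound
      assms(13)[unfolded pmax_def] assms(16) assms(15)[unfolded F_def]]
  \<comment> \<open>The normalised variance is squeezed between 0 and
    \<open>p n / pmax n - 1\<close>, which tends to 0 by the assumption on the ratio.\<close>
  show ?thesis
  proof (rule tendsto_sandwich[where f="\<lambda>_. 0" and h="\<lambda>n. p n / pmax n - 1"])
    show "(\<lambda>n. p n / pmax n - 1) \<longlonglongrightarrow> 0"
      using tendsto_diff[OF assms(14) tendsto_const[of 1]] by simp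
  qed (use bounds in \<open>simp_all add: p_def pmax_def F_def\<close>)
qed

end
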